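(* Let $E$ be a strict $(LF)$-space. Then $E$ is $\kappa$-Fréchet--Urysohn if and only if $E$ is a Fréchet space.
   Context: A topological space $X$ is $\kappa$-Fréchet--Urysohn if for every open subset $U$ of $X$ and every $x\in\overline{U}$ there exists a sequence $\{x_n\}_{n\in\mathbb{N}}\subseteq U$ converging to $x$. Spaces are over $\mathbf{F}=\mathbb{R}$ or $\mathbb{C}$. A Fréchet space is a locally convex complete metrizable topological vector space. A strict $(LF)$-space $E$ is the direct limit of an increasing sequence $E_0\hookrightarrow E_1\hookrightarrow E_2\hookrightarrow\cdots$ of Fréchet spaces in the category of locally convex spaces and continuous linear maps, where (strictness) each $E_n\hookrightarrow E_{n+1}$ is a linear topological embedding, i.e., $E_n$ carries the topology induced from $E_{n+1}$. *)

theory Defs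
  imports "HOL-Analysis.Analysis"
begin

text \<open>A topological vector space over a normed field is given by a topology on a linear subspace
  of an ambient vector space; its carrier is the topspace.  Thus all members of an increasing
  sequence of spaces, and their direct limit, live in one ambient vector space.  No separation
  axiom is imposed on topological vector spaces or on locally convex spaces.\<close>

definition topological_vector_space ::
    "('k::real_normed_field \<Rightarrow> 'a::ab_group_add \<Rightarrow> 'a) \<Rightarrow> 'a topology \<Rightarrow> bool" where
  "topological_vector_space smul T \<longleftrightarrow>
     vector_space smul \<and>
     module.subspace smul (topspace T) \<and>
     continuous_map (prod_topology T T) T (\<lambda>(x, y). x + y) \<and>
     continuous_map (prod_topology euclidean T) T (\<lambda>(c, x). smul c x)"

definition convex_wrt ::
    "('k::real_normed_field \<Rightarrow> 'a::ab_group_add \<Rightarrow> 'a) \<Rightarrow> 'a set \<Rightarrow> bool" where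
  "convex_wrt smul C \<longleftrightarrow>
     (\<forall>x\<in>C. \<forall>y\<in>C. \<forall>u\<ge>0. \<forall>v\<ge>0. u + v = 1 \<longrightarrow>
        smul (of_real u) x + smul (of_real v) y \<in> C)"

definition locally_convex_space ::
    "('k::real_normed_field \<Rightarrow> 'a::ab_group_add \<Rightarrow> 'a) \<Rightarrow> 'a topology \<Rightarrow> bool" where
  "locally_convex_space smul T \<longleftrightarrow>
     topological_vector_space smul T \<and>
     (\<forall>U. openin T U \<and> 0 \<in> U \<longrightarrow>
        (\<exists>V. openin T V \<and> 0 \<in> V \<and> convex_wrt smul V \<and> V \<subseteq> U))"

text \<open>Completeness refers to the canonical uniformity of the additive group: every proper Cauchy
  filter on the carrier converges.\<close>

definition tvs_cauchy_filter :: "'a::ab_group_add topology \<Rightarrow> 'a filter \<Rightarrow> bool" where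
  "tvs_cauchy_filter T \<F> \<longleftrightarrow>
     (\<forall>U. openin T U \<and> 0 \<in> U \<longrightarrow> (\<forall>\<^sub>F (x, y) in \<F> \<times>\<^sub>F \<F>. x - y \<in> U))"

definition tvs_complete :: "'a::ab_group_add topology \<Rightarrow> bool" where
  "tvs_complete T \<longleftrightarrow>
     (\<forall>\<F>. \<F> \<noteq> bot \<and> \<F> \<le> principal (topspace T) \<and> tvs_cauchy_filter T \<F> \<longrightarrow>
        (\<exists>l. limitin T (\<lambda>x. x) l \<F>))"

definition Frechet_space ::
    "('k::real_normed_field \<Rightarrow> 'a::ab_group_add \<Rightarrow> 'a) \<Rightarrow> 'a topology \<Rightarrow> bool" where
  "Frechet_space smul T \<longleftrightarrow>
     locally_convex_space smul T \<and> metrizable_space T \<and> tvs_complete T"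

definition continuous_linear_map ::
    "('k::real_normed_field \<Rightarrow> 'a::ab_group_add \<Rightarrow> 'a) \<Rightarrow> 'a topology \<Rightarrow>
     ('k \<Rightarrow> 'b::ab_group_add \<Rightarrow> 'b) \<Rightarrow> 'b topology \<Rightarrow> ('a \<Rightarrow> 'b) \<Rightarrow> bool" where
  "continuous_linear_map smul T smul' T' f \<longleftrightarrow>
     continuous_map T T' f \<and>
     (\<forall>x\<in>topspace T. \<forall>y\<in>topspace T. f (x + y) = f x + f y) \<and>
     (\<forall>c. \<forall>x\<in>topspace T. f (smul c x) = smul' c (f x))"

text \<open>The universal property of \<open>T\<close>, with the inclusions \<open>S n \<hookrightarrow> T\<close> as cocone, relative to one test
  space \<open>F\<close>.\<close>

definition colimit_property ::
    "('k::real_normed_field \<Rightarrow> 'a::ab_group_add \<Rightarrow> 'a) \<Rightarrow> (nat \<Rightarrow> 'a topology) \<Rightarrow> 'a topology \<Rightarrow>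
     ('k \<Rightarrow> 'b::ab_group_add \<Rightarrow> 'b) \<Rightarrow> 'b topology \<Rightarrow> bool" where
  "colimit_property smul S T smul' F \<longleftrightarrow>
     (\<forall>f. (\<forall>n. continuous_linear_map smul (S n) smul' F (f n)) \<and>
          (\<forall>n. \<forall>x\<in>topspace (S n). f (Suc n) x = f n x) \<longrightarrow>
        (\<exists>g. continuous_linear_map smul T smul' F g \<and>
             (\<forall>n. \<forall>x\<in>topspace (S n). g x = f n x) \<and>
             (\<forall>h. continuous_linear_map smul T smul' F h \<and>
                  (\<forall>n. \<forall>x\<in>topspace (S n). h x = f n x) \<longrightarrow>
                  (\<forall>x\<in>topspace T. h x = g x))))"

text \<open>Direct limit in the category of locally convex spaces.  HOL cannot quantify over types, so
  the test spaces range over the locally convex spaces inside the ambient space.  This is no loss: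
  \<open>lc_direct_limit_universal\<close> below gives the property for test spaces over every type, and
  \<open>lc_direct_limit_iff_finest\<close> gives the usual description as the finest locally
  convex topology on the union.\<close>

definition lc_direct_limit ::
    "('k::real_normed_field \<Rightarrow> 'a::ab_group_add \<Rightarrow> 'a) \<Rightarrow> (nat \<Rightarrow> 'a topology) \<Rightarrow> 'a topology \<Rightarrow> bool"
  where
  "lc_direct_limit smul S T \<longleftrightarrow>
     locally_convex_space smul T \<and>
     (\<forall>n. continuous_linear_map smul (S n) smul T (\<lambda>x. x)) \<and>
     (\<forall>F. locally_convex_space smul F \<longrightarrow> colimit_property smul S T smul F)"

text \<open>The sequence need not be strictly increasing.\<close>

definition strict_LF_space ::
    "('k::real_normed_field \<Rightarrow> 'a::ab_group_add \<Rightarrow> 'a) \<Rightarrow> 'a topology \<Rightarrow> bool" where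
  "strict_LF_space smul T \<longleftrightarrow>
     (\<exists>S :: nat \<Rightarrow> 'a topology.
        (\<forall>n. Frechet_space smul (S n)) \<and>
        (\<forall>n. topspace (S n) \<subseteq> topspace (S (Suc n)) \<and>
             S n = subtopology (S (Suc n)) (topspace (S n))) \<and>
        lc_direct_limit smul S T)"

definition kappa_Frechet_Urysohn :: "'a topology \<Rightarrow> bool" where
  "kappa_Frechet_Urysohn T \<longleftrightarrow>
     (\<forall>U x. openin T U \<and> x \<in> T closure_of U \<longrightarrow>
        (\<exists>s :: nat \<Rightarrow> 'a. range s \<subseteq> U \<and> limitin T s x sequentially))"


lemma locally_convex_spaceD:
  assumes "locally_convex_space smul T"
  shows "vector_space smul" "module smul" "module.subspace smul (topspace T)"
    "continuous_map (prod_topology T T) T (\<lambda>(x, y). x + y)"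
    "continuous_map (prod_topology euclidean T) T (\<lambda>(c, x). smul c x)"
    "\<And>U. openin T U \<Longrightarrow> 0 \<in> U \<Longrightarrow>
        \<exists>V. openin T V \<and> 0 \<in> V \<and> convex_wrt smul V \<and> V \<subseteq> U"
  using assms
  by (auto simp: locally_convex_space_def topological_vector_space_def module_iff_vector_space)

lemma subspace_closed:
  assumes "module smul" "module.subspace smul V"
  shows "0 \<in> V" "\<And>x y. x \<in> V \<Longrightarrow> y \<in> V \<Longrightarrow> x + y \<in> V"
    "\<And>c x. x \<in> V \<Longrightarrow> smul c x \<in> V"
  using assms by (auto simp: module.subspace_def)

lemma locally_convex_space_pullback:
  fixes smul :: "'k::real_normed_field \<Rightarrow> 'a::ab_group_add \<Rightarrow> 'a"
    and smul' :: "'k \<Rightarrow> 'b::ab_group_add \<Rightarrow> 'b"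
  assumes vs: "vector_space smul" and A: "module.subspace smul A"
    and F: "locally_convex_space smul' F"
    and gF: "g ` A \<subseteq> topspace F"
    and add: "\<And>x y. x \<in> A \<Longrightarrow> y \<in> A \<Longrightarrow> g (x + y) = g x + g y"
    and scl: "\<And>c x. x \<in> A \<Longrightarrow> g (smul c x) = smul' c (g x)"
  shows "locally_convex_space smul (pullback_topology A g F)"
proof -
  let ?P = "pullback_topology A g F"
  have mod: "module smul" using vs by (simp add: module_iff_vector_space)
  note Ac = subspace_closed[OF mod A]
  note FD = locally_convex_spaceD[OF F]
  have ts: "topspace ?P = A"
    using gF by (auto simp: topspace_pullback_topology)
  have gcont: "continuous_map ?P F g"
    using continuous_map_pullback[of F F id A g] by simp
  have "continuous_map (prod_topology ?P ?P) F (g \<circ> (\<lambda>(x, y). x + y))"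
  proof -
    have c: "continuous_map (prod_topology ?P ?P) (prod_topology F F) (\<lambda>z. (g (fst z), g (snd z)))"
      by (intro continuous_map_pairedI continuous_map_compose[OF continuous_map_fst gcont, unfolded o_def]
          continuous_map_compose[OF continuous_map_snd gcont, unfolded o_def])
    show ?thesis
      by (rule continuous_map_eq[OF continuous_map_compose[OF c FD(4)]])
         (auto simp: ts add)
  qed
  then have addc: "continuous_map (prod_topology ?P ?P) ?P (\<lambda>(x, y). x + y)"
    by (rule continuous_map_pullback') (auto simp: ts Ac)
  have "continuous_map (prod_topology euclidean ?P) F (g \<circ> (\<lambda>(c, x). smul c x))"
  proof -
    have c: "continuous_map (prod_topology euclidean ?P) (prod_topology euclidean F)
        (\<lambda>z. (fst z, g (snd z)))"
      by (intro continuous_map_pairedI continuous_map_fst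
          continuous_map_compose[OF continuous_map_snd gcont, unfolded o_def])
    show ?thesis
      by (rule continuous_map_eq[OF continuous_map_compose[OF c FD(5)]])
         (auto simp: ts scl)
  qed
  then have sclc: "continuous_map (prod_topology euclidean ?P) ?P (\<lambda>(c, x). smul c x)"
    by (rule continuous_map_pullback') (auto simp: ts Ac)
  have g0: "g 0 = 0"
    using add[OF Ac(1) Ac(1)] by simp
  have "\<exists>V. openin ?P V \<and> 0 \<in> V \<and> convex_wrt smul V \<and> V \<subseteq> U"
    if U: "openin ?P U" "0 \<in> U" for U
  proof -
    obtain W where W: "openin F W" "U = g -` W \<inter> A"
      using U by (auto simp: openin_pullback_topology)
    obtain V where V: "openin F V" "0 \<in> V" "convex_wrt smul' V" "V \<subseteq> W"
      using FD(6)[OF W(1)] W(2) U(2) g0 by auto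
    have "convex_wrt smul (g -` V \<inter> A)"
      using V(3) Ac by (auto simp: convex_wrt_def add scl)
    then show ?thesis
      using V W U g0 Ac(1)
      by (intro exI[of _ "g -` V \<inter> A"]) (auto simp: openin_pullback_topology)
  qed
  then show ?thesis
    unfolding locally_convex_space_def topological_vector_space_def
    using vs A addc sclc by (simp add: ts)
qed

lemma lc_direct_limit_topspace:
  fixes smul :: "'k::real_normed_field \<Rightarrow> 'a::ab_group_add \<Rightarrow> 'a"
  assumes lim: "lc_direct_limit smul S T"
    and S: "\<And>n. topological_vector_space smul (S n)"
    and inc: "\<And>n. topspace (S n) \<subseteq> topspace (S (Suc n))"
  shows "topspace T = (\<Union>n. topspace (S n))"
proof (rule ccontr)
  let ?W = "\<Union>n. topspace (S n)"
  assume ne: "topspace T \<noteq> ?W"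
  have T: "locally_convex_space smul T" using lim by (simp add: lc_direct_limit_def)
  have leg: "continuous_linear_map smul (S n) smul T (\<lambda>x. x)" for n
    using lim by (simp add: lc_direct_limit_def)
  have "?W \<subseteq> topspace T"
    using leg by (fastforce simp: continuous_linear_map_def continuous_map_def)
  with ne obtain x where x: "x \<in> topspace T" "x \<notin> ?W" by blast
  interpret vector_space smul using locally_convex_spaceD(1)[OF T] .
  have sub: "subspace (topspace (S n))" for n
    using S by (simp add: topological_vector_space_def)
  have mono: "topspace (S m) \<subseteq> topspace (S n)" if "m \<le> n" for m n
    using lift_Suc_mono_le[of "\<lambda>n. topspace (S n)", OF inc that] .
  have "subspace ?W"
  proof (rule subspaceI)
    show "0 \<in> ?W" using subspace_0[OF sub] by auto
  next
    fix u v assume "u \<in> ?W" "v \<in> ?W"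
    then obtain m n where "u \<in> topspace (S m)" "v \<in> topspace (S n)" by auto
    then have "u \<in> topspace (S (max m n))" "v \<in> topspace (S (max m n))"
      using mono[of m "max m n"] mono[of n "max m n"] by auto
    then show "u + v \<in> ?W" using subspace_add[OF sub] by blast
  next
    fix c u assume "u \<in> ?W"
    then show "smul c u \<in> ?W" using subspace_scale[OF sub] by blast
  qed
  obtain B where B: "B \<subseteq> ?W" "independent B" "?W \<subseteq> span B"
    using maximal_independent_subset by blast
  have "span B \<subseteq> ?W" using span_minimal[OF B(1) \<open>subspace ?W\<close>] .
  then have ind: "independent (insert x B)"
    using x(2) B(2) by (intro independent_insertI) auto
  interpret pair: vector_space_pair smul smul ..
  obtain g where g: "Vector_Spaces.linear smul smul g"
      "\<forall>b\<in>insert x B. g b = (if b = x then x else 0)"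
    using pair.linear_independent_extend[OF ind, of "\<lambda>b. if b = x then x else 0"] by blast
  interpret g: Vector_Spaces.linear smul smul g by fact
  have gB: "g b = 0" if "b \<in> B" for b
    using g(2) that B(1) x(2) by auto
  have gW: "g w = 0" if "w \<in> ?W" for w
    using g.eq_0_on_span[OF gB, of B w] B(3) that by auto
  have gx: "g x = x" using g(2) by simp
  have "x \<noteq> 0" using x(2) subspace_0[OF \<open>subspace ?W\<close>] by auto
  let ?F = "pullback_topology UNIV (\<lambda>_::'a. 0) T"
  have F: "locally_convex_space smul ?F"
    by (rule locally_convex_space_pullback[OF vector_space_axioms subspace_UNIV T])
       (use subspace_closed[OF module_axioms locally_convex_spaceD(3)[OF T]] in auto)
  have zT: "0 \<in> topspace T"
    using subspace_closed[OF module_axioms locally_convex_spaceD(3)[OF T]] by auto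
  have anyc: "continuous_map X ?F h" for X :: "'a topology" and h
    by (rule continuous_map_pullback') (auto simp: o_def zT)
  have Z: "continuous_linear_map smul X smul ?F (\<lambda>_. 0)" for X :: "'a topology"
    unfolding continuous_linear_map_def by (intro conjI anyc) auto
  have G: "continuous_linear_map smul T smul ?F g"
    unfolding continuous_linear_map_def by (intro conjI anyc) (auto simp: g.add g.scale)
  have "colimit_property smul S T smul ?F"
    using lim F by (simp add: lc_direct_limit_def)
  from this[unfolded colimit_property_def, rule_format, of "\<lambda>_ _. 0"]
  obtain k where "\<forall>h. continuous_linear_map smul T smul ?F h \<and>
      (\<forall>n. \<forall>x\<in>topspace (S n). h x = 0) \<longrightarrow> (\<forall>x\<in>topspace T. h x = k x)"
    using Z by auto
  then have k: "\<forall>x\<in>topspace T. h x = k x"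
    if "continuous_linear_map smul T smul ?F h" "\<forall>n. \<forall>x\<in>topspace (S n). h x = 0" for h
    using that by blast
  have "g x = k x" using k[OF G] gW x(1) by blast
  moreover have "0 = k x" using k[OF Z] x(1) by blast
  ultimately show False using gx \<open>x \<noteq> 0\<close> by simp
qed

lemma lc_direct_limit_finest:
  fixes smul :: "'k::real_normed_field \<Rightarrow> 'a::ab_group_add \<Rightarrow> 'a"
  assumes lim: "lc_direct_limit smul S T"
    and S: "\<And>n. topological_vector_space smul (S n)"
    and inc: "\<And>n. topspace (S n) \<subseteq> topspace (S (Suc n))"
    and F: "locally_convex_space smul F" "topspace F = topspace T"
    and cont: "\<And>n. continuous_map (S n) F (\<lambda>x. x)"
  shows "continuous_map T F (\<lambda>x. x)"
proof -
  note ts = lc_direct_limit_topspace[where S=S, OF lim S inc]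
  have "colimit_property smul S T smul F"
    using lim F by (simp add: lc_direct_limit_def)
  then obtain g where g: "continuous_linear_map smul T smul F g"
      "\<forall>n. \<forall>x\<in>topspace (S n). g x = x"
    unfolding colimit_property_def using cont
    by (elim allE[of _ "\<lambda>_ x. x"]) (auto simp: continuous_linear_map_def)
  show ?thesis
    by (rule continuous_map_eq[of T F g]) (use g ts in \<open>auto simp: continuous_linear_map_def\<close>)
qed

lemma colimit_property_if_finest:
  fixes smul :: "'k::real_normed_field \<Rightarrow> 'a::ab_group_add \<Rightarrow> 'a"
    and smul' :: "'k \<Rightarrow> 'b::ab_group_add \<Rightarrow> 'b"
  assumes T: "locally_convex_space smul T"
    and ts: "topspace T = (\<Union>n. topspace (S n))"
    and inc: "\<And>n. topspace (S n) \<subseteq> topspace (S (Suc n))"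
    and finest: "\<And>F. locally_convex_space smul F \<Longrightarrow> topspace F = topspace T \<Longrightarrow>
       (\<And>n. continuous_map (S n) F (\<lambda>x. x)) \<Longrightarrow> continuous_map T F (\<lambda>x. x)"
    and S: "\<And>n. topological_vector_space smul (S n)"
    and F: "locally_convex_space smul' F"
  shows "colimit_property smul S T smul' F"
  unfolding colimit_property_def
proof (intro allI impI)
  fix f :: "nat \<Rightarrow> 'a \<Rightarrow> 'b"
  assume "(\<forall>n. continuous_linear_map smul (S n) smul' F (f n)) \<and>
          (\<forall>n. \<forall>x\<in>topspace (S n). f (Suc n) x = f n x)"
  then have f: "\<And>n. continuous_linear_map smul (S n) smul' F (f n)"
    and fc: "\<And>n x. x \<in> topspace (S n) \<Longrightarrow> f (Suc n) x = f n x" by auto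
  have mod: "module smul" using locally_convex_spaceD(2)[OF T] .
  have mono: "topspace (S m) \<subseteq> topspace (S n)" if "m \<le> n" for m n
    using lift_Suc_mono_le[of "\<lambda>n. topspace (S n)", OF inc that] .
  have fle: "f n x = f m x" if "m \<le> n" "x \<in> topspace (S m)" for m n x
    using that
  proof (induction n rule: dec_induct)
    case base then show ?case by simp
  next
    case (step n) then show ?case using fc[of x n] mono[of m n] by auto
  qed
  define g where "g x = f (LEAST n. x \<in> topspace (S n)) x" for x
  have g: "g x = f n x" if "x \<in> topspace (S n)" for n x
    unfolding g_def using fle[of "LEAST n. x \<in> topspace (S n)" n x] that
    by (metis (no_types, lifting) LeastI Least_le)
  have sub: "module.subspace smul (topspace (S n))" for n
    using S by (simp add: topological_vector_space_def)
  have gadd: "g (x + y) = g x + g y" if xy: "x \<in> topspace T" "y \<in> topspace T" for x y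
  proof -
    obtain m n where "x \<in> topspace (S m)" "y \<in> topspace (S n)" using xy ts by auto
    then have *: "x \<in> topspace (S (max m n))" "y \<in> topspace (S (max m n))"
      using mono[of m "max m n"] mono[of n "max m n"] by auto
    show ?thesis
      using f[of "max m n"] g[OF *(1)] g[OF *(2)] g[OF subspace_closed(2)[OF mod sub *]] *
      by (auto simp: continuous_linear_map_def)
  qed
  have gscl: "g (smul c x) = smul' c (g x)" if x: "x \<in> topspace T" for c x
  proof -
    obtain n where *: "x \<in> topspace (S n)" using x ts by auto
    show ?thesis
      using f[of n] g[OF *] g[OF subspace_closed(3)[OF mod sub *]] *
      by (auto simp: continuous_linear_map_def)
  qed
  have gF: "g ` topspace T \<subseteq> topspace F"
    using f g ts by (fastforce simp: continuous_linear_map_def continuous_map_def)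
  let ?P = "pullback_topology (topspace T) g F"
  have P: "locally_convex_space smul ?P"
    using locally_convex_spaceD(1,3)[OF T] F gF
    by (rule locally_convex_space_pullback[where g=g]) (auto simp: gadd gscl)
  have "continuous_map T ?P (\<lambda>x. x)"
  proof (rule finest[OF P])
    show "topspace ?P = topspace T" using gF by (auto simp: topspace_pullback_topology)
    show "continuous_map (S n) ?P (\<lambda>x. x)" for n
    proof (rule continuous_map_pullback')
      show "continuous_map (S n) F (g \<circ> (\<lambda>x. x))"
        by (rule continuous_map_eq[of _ _ "f n"])
           (use f[of n] g in \<open>auto simp: continuous_linear_map_def\<close>)
    qed (use ts in auto)
  qed
  moreover have "continuous_map ?P F g"
    using continuous_map_pullback[of F F id "topspace T" g] by simp
  ultimately have "continuous_map T F g"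
    using continuous_map_compose[of T ?P "\<lambda>x. x" F g] by (simp add: o_def)
  then have "continuous_linear_map smul T smul' F g"
    by (simp add: continuous_linear_map_def gadd gscl)
  then show "\<exists>g. continuous_linear_map smul T smul' F g \<and>
             (\<forall>n. \<forall>x\<in>topspace (S n). g x = f n x) \<and>
             (\<forall>h. continuous_linear_map smul T smul' F h \<and>
                  (\<forall>n. \<forall>x\<in>topspace (S n). h x = f n x) \<longrightarrow>
                  (\<forall>x\<in>topspace T. h x = g x))"
    by (intro exI[of _ g]) (auto simp: ts g)
qed

theorem lc_direct_limit_universal:
  fixes smul :: "'k::real_normed_field \<Rightarrow> 'a::ab_group_add \<Rightarrow> 'a"
    and smul' :: "'k \<Rightarrow> 'b::ab_group_add \<Rightarrow> 'b"
  assumes lim: "lc_direct_limit smul S T"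
    and S: "\<And>n. topological_vector_space smul (S n)"
    and inc: "\<And>n. topspace (S n) \<subseteq> topspace (S (Suc n))"
    and F: "locally_convex_space smul' F"
  shows "colimit_property smul S T smul' F"
  using lc_direct_limit_topspace[where S=S, OF lim S inc] lc_direct_limit_finest[where S=S and T=T, OF lim S inc] lim
  by (intro colimit_property_if_finest[where S=S and T=T, OF _ _ inc _ S F]) (auto simp: lc_direct_limit_def)

theorem lc_direct_limit_iff_finest:
  fixes smul :: "'k::real_normed_field \<Rightarrow> 'a::ab_group_add \<Rightarrow> 'a"
  assumes S: "\<And>n. topological_vector_space smul (S n)"
    and inc: "\<And>n. topspace (S n) \<subseteq> topspace (S (Suc n))"
  shows "lc_direct_limit smul S T \<longleftrightarrow>
     locally_convex_space smul T \<and>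
     topspace T = (\<Union>n. topspace (S n)) \<and>
     (\<forall>n. continuous_map (S n) T (\<lambda>x. x)) \<and>
     (\<forall>F. locally_convex_space smul F \<and> topspace F = topspace T \<and>
          (\<forall>n. continuous_map (S n) F (\<lambda>x. x)) \<longrightarrow> (\<forall>U. openin F U \<longrightarrow> openin T U))"
    (is "_ \<longleftrightarrow> ?R")
proof -
  have id: "continuous_map T F (\<lambda>x. x) \<longleftrightarrow> (\<forall>U. openin F U \<longrightarrow> openin T U)"
    if "topspace F = topspace T" for F
  proof -
    have "{x \<in> topspace T. x \<in> U} = U" if "openin F U" for U
      using openin_subset[OF that] \<open>topspace F = topspace T\<close> by auto
    then show ?thesis using that by (auto simp: continuous_map_def)
  qed
  show ?thesis
  proof
    assume lim: "lc_direct_limit smul S T"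
    show ?R
      using lim lc_direct_limit_topspace[where S=S, OF lim S inc] lc_direct_limit_finest[where S=S and T=T, OF lim S inc] id
      by (auto simp: lc_direct_limit_def continuous_linear_map_def)
  next
    assume R: ?R
    have "colimit_property smul S T smul F" if "locally_convex_space smul F" for F
      by (rule colimit_property_if_finest[where S=S and T=T, OF _ _ inc _ S that]) (use R id in auto)
    then show "lc_direct_limit smul S T"
      using R by (auto simp: lc_direct_limit_def continuous_linear_map_def)
  qed
qed

end

theory Submission
  imports Defs
begin

text \<open>Suppose that no step \<open>S n\<close> of a strict (LF)-space is the whole space.  Strictness allows a
  continuous seminorm on \<open>S n\<close> to be extended step by step to the limit while keeping it \<open>\<ge> 1\<close> at
  one prescribed point of each \<open>S (n + 1) - S n\<close>; hence every step is closed in the limit, and a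
  null sequence stays inside some step.  For a non-zero continuous seminorm \<open>P\<close>, the open set
  \<open>U = (\<Union>n. {y. P y > 1 / (n + 1)} - S n)\<close> has 0 in its closure, because proper subspaces have empty
  interior; but \<open>P > 1 / (m + 1)\<close> on \<open>U \<inter> S m\<close>, so no sequence in \<open>U\<close> converges to 0.  Thus a
  \<open>\<kappa>\<close>-Frechet--Urysohn limit coincides with one of its steps.\<close>

section \<open>Seminorms on a subspace and their continuity\<close>

definition seminorm_on ::
    "('k::real_normed_field \<Rightarrow> 'a::ab_group_add \<Rightarrow> 'a) \<Rightarrow> 'a set \<Rightarrow> ('a \<Rightarrow> real) \<Rightarrow> bool" where
  "seminorm_on smul A p \<longleftrightarrow>
     (\<forall>x\<in>A. \<forall>y\<in>A. p (x + y) \<le> p x + p y) \<and> (\<forall>c. \<forall>x\<in>A. p (smul c x) = norm c * p x)"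

definition continuous_seminorm ::
    "('k::real_normed_field \<Rightarrow> 'a::ab_group_add \<Rightarrow> 'a) \<Rightarrow> 'a topology \<Rightarrow> ('a \<Rightarrow> real) \<Rightarrow> bool" where
  "continuous_seminorm smul X p \<longleftrightarrow>
     seminorm_on smul (topspace X) p \<and> continuous_map X euclideanreal p"

lemma seminorm_onD:
  assumes "module smul" "module.subspace smul A" "seminorm_on smul A p"
  shows "x \<in> A \<Longrightarrow> y \<in> A \<Longrightarrow> p (x + y) \<le> p x + p y"
    and "x \<in> A \<Longrightarrow> p (smul c x) = norm c * p x"
    and "p 0 = 0"
    and "x \<in> A \<Longrightarrow> p (- x) = p x"
    and "x \<in> A \<Longrightarrow> p x \<ge> 0"
    and "x \<in> A \<Longrightarrow> y \<in> A \<Longrightarrow> p (x - y) = p (y - x)"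
    and "x \<in> A \<Longrightarrow> y \<in> A \<Longrightarrow> \<bar>p x - p y\<bar> \<le> p (x - y)"
proof -
  interpret module smul by fact
  note A = assms(2)
  show add: "p (x + y) \<le> p x + p y" if "x \<in> A" "y \<in> A" for x y
    using assms(3) that by (auto simp: seminorm_on_def)
  show scl: "p (smul c x) = norm c * p x" if "x \<in> A" for c x
    using assms(3) that by (auto simp: seminorm_on_def)
  show p0: "p 0 = 0"
    using scl[OF subspace_0[OF A], of 0] by simp
  show neg: "p (- x) = p x" if "x \<in> A" for x
    using scl[OF that, of "- 1"] by simp
  show "p x \<ge> 0" if "x \<in> A" for x
    using add[OF that subspace_neg[OF A that]] neg[OF that] p0 by simp
  show sym: "p (x - y) = p (y - x)" if "x \<in> A" "y \<in> A" for x y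
    using neg[OF subspace_diff[OF A that]] by simp
  show "\<bar>p x - p y\<bar> \<le> p (x - y)" if "x \<in> A" "y \<in> A" for x y
    using add[OF subspace_diff[OF A that] that(2)] add[OF subspace_diff[OF A that(2,1)] that(1)]
      sym[OF that]
    by simp
qed

text \<open>Homogeneity as an inequality suffices: applied to \<open>inverse c\<close> and
  \<open>smul c x\<close> it gives the reverse estimate, and \<open>p 0 = 0\<close> settles
  \<open>c = 0\<close>.\<close>

lemma seminorm_onI:
  fixes smul :: "'k::real_normed_field \<Rightarrow> 'a::ab_group_add \<Rightarrow> 'a"
  assumes "module smul" "module.subspace smul A"
    and "\<And>x y. x \<in> A \<Longrightarrow> y \<in> A \<Longrightarrow> p (x + y) \<le> p x + p y"
    and scl: "\<And>c x. x \<in> A \<Longrightarrow> c \<noteq> 0 \<Longrightarrow> p (smul c x) \<le> norm c * p x"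
    and p0: "p 0 = 0"
  shows "seminorm_on smul A p"
proof -
  interpret module smul by fact
  have "p (smul c x) = norm c * p x" if x: "x \<in> A" for c x
  proof (cases "c = 0")
    case False
    have "p (smul (inverse c) (smul c x)) \<le> norm (inverse c) * p (smul c x)"
      using x False subspace_scale[OF assms(2)] by (intro scl) auto
    then have "norm c * p x \<le> p (smul c x)"
      using False by (simp add: nonzero_norm_inverse norm_divide field_simps)
    then show ?thesis using scl[OF x False] by simp
  qed (simp add: p0)
  then show ?thesis using assms(3) by (simp add: seminorm_on_def)
qed

lemma seminorm_on_zero: "seminorm_on smul A (\<lambda>_. 0)"
  by (simp add: seminorm_on_def)

lemma continuous_seminorm_zero: "continuous_seminorm smul X (\<lambda>_. 0)"
  by (simp add: continuous_seminorm_def seminorm_on_zero)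

lemma continuous_seminorm_less:
  assumes "continuous_seminorm smul X p"
  shows "openin X {x \<in> topspace X. p x < r}" "openin X {x \<in> topspace X. r < p x}"
  using assms openin_continuous_map_preimage[of X euclideanreal p "{..<r}"]
    openin_continuous_map_preimage[of X euclideanreal p "{r<..}"]
  by (auto simp: continuous_seminorm_def)

section \<open>Locally convex spaces: gauges, extension of seminorms, closedness of complete
  subspaces\<close>

locale lc_space =
  fixes smul :: "'k::real_normed_field \<Rightarrow> 'a::ab_group_add \<Rightarrow> 'a" and X :: "'a topology"
  assumes lc: "locally_convex_space smul X"
begin

sublocale vector_space smul
  using locally_convex_spaceD(1)[OF lc] .

lemmas subspace_topspace = locally_convex_spaceD(3)[OF lc]

lemma continuous_map_add:
  assumes "continuous_map Y X f" "continuous_map Y X g"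
  shows "continuous_map Y X (\<lambda>y. f y + g y)"
  using continuous_map_compose[OF continuous_map_pairedI[OF assms] locally_convex_spaceD(4)[OF lc]]
  by (simp add: o_def)

lemma continuous_map_smul:
  assumes "continuous_map Y euclidean f" "continuous_map Y X g"
  shows "continuous_map Y X (\<lambda>y. smul (f y) (g y))"
  using continuous_map_compose[OF continuous_map_pairedI[OF assms] locally_convex_spaceD(5)[OF lc]]
  by (simp add: o_def)

lemma continuous_map_diff:
  assumes "continuous_map Y X f" "continuous_map Y X g"
  shows "continuous_map Y X (\<lambda>y. f y - g y)"
  using continuous_map_add[OF assms(1) continuous_map_smul[OF _ assms(2), of "\<lambda>_. - 1"]] by simp

text \<open>For \<open>c \<noteq> 0\<close> this is the scaled translate
  \<open>y + (1 / c) U\<close>, the form in which neighbourhoods of \<open>y\<close> are produced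
  below.\<close>

lemma openin_smul_diff:
  assumes "openin X U" "y \<in> topspace X"
  shows "openin X {z \<in> topspace X. smul c (z - y) \<in> U}"
  by (rule openin_continuous_map_preimage[OF _ assms(1)])
     (use assms(2) in \<open>intro continuous_map_smul continuous_map_diff\<close>, auto)

text \<open>A bound near 0 spreads to every point \<open>y\<close> by translation and scaling, since
  \<open>\<bar>p z - p y\<bar> \<le> p (z - y)\<close>.\<close>

lemma continuous_seminormI:
  assumes p: "seminorm_on smul (topspace X) p"
    and U: "openin X U" "0 \<in> U" "\<And>x. x \<in> U \<Longrightarrow> p x \<le> 1"
  shows "continuous_seminorm smul X p"
proof -
  note pD = seminorm_onD[OF module_axioms subspace_topspace p]
  have pre: "openin X {x \<in> topspace X. p x \<in> B}" if B: "open B" for B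
  proof (subst openin_subopen, safe)
    fix y assume y: "y \<in> topspace X" "p y \<in> B"
    obtain e where e: "e > 0" "\<And>r. \<bar>r - p y\<bar> < e \<Longrightarrow> r \<in> B"
      using B y(2) by (auto simp: open_dist dist_real_def)
    \<comment> \<open>The factor \<open>2 / e\<close> yields \<open>p (z - y) \<le> e / 2\<close>,
      which is strictly below \<open>e\<close>.\<close>
    let ?N = "{z \<in> topspace X. smul (of_real (2 / e)) (z - y) \<in> U}"
    have "p z \<in> B" if z: "z \<in> ?N" for z
    proof -
      have zX: "z \<in> topspace X" using z by simp
      have "p (smul (of_real (2 / e)) (z - y)) \<le> 1" using z U(3) by auto
      then have "2 / e * p (z - y) \<le> 1"
        using e(1) by (simp add: norm_divide pD(2)[OF subspace_diff[OF subspace_topspace zX y(1)]])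
      then have "p (z - y) < e" using e(1) by (simp add: field_simps)
      then show ?thesis using pD(7)[OF zX y(1)] by (intro e(2)) linarith
    qed
    then show "\<exists>N. openin X N \<and> y \<in> N \<and> N \<subseteq> {x \<in> topspace X. p x \<in> B}"
      using openin_smul_diff[OF U(1) y(1), of "of_real (2 / e)"] y U(2) by (intro exI[of _ ?N]) auto
  qed
  have "continuous_map X euclideanreal p"
    unfolding continuous_map_def
  proof (intro conjI allI impI)
    show "openin X {x \<in> topspace X. p x \<in> B}" if "openin euclideanreal B" for B
      using that by (intro pre) (rule open_openin[THEN iffD2])
  qed simp
  with p show ?thesis by (simp only: continuous_seminorm_def)
qed

text \<open>Continuity of \<open>c \<mapsto> smul c x\<close> at 0 makes neighbourhoods of 0
  absorbing.\<close>

lemma eventually_smul_mem: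
  assumes U: "openin X U" "0 \<in> U" and x: "x \<in> topspace X"
  shows "\<exists>d>0. \<forall>c. norm c < d \<longrightarrow> smul c x \<in> U"
proof -
  have "open {c. smul c x \<in> U}"
    using openin_continuous_map_preimage[OF continuous_map_smul[of euclidean "\<lambda>c. c" "\<lambda>_. x"] U(1)] x
    by simp
  moreover have "0 \<in> {c. smul c x \<in> U}" using U(2) by simp
  ultimately obtain d where d: "d > 0" "ball 0 d \<subseteq> {c. smul c x \<in> U}"
    by (rule openE)
  have "smul c x \<in> U" if "norm c < d" for c
    using subsetD[OF d(2), of c] that by simp
  then show ?thesis using d(1) by blast
qed

text \<open>The seminorm is the gauge of the balanced core of a convex neighbourhood.\<close>

lemma gauge_exists:
  assumes U: "openin X U" "0 \<in> U"
  shows "\<exists>q. continuous_seminorm smul X q \<and> (\<forall>x\<in>topspace X. q x < 1 \<longrightarrow> x \<in> U)"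
proof -
  obtain V where V: "openin X V" "0 \<in> V" "convex_wrt smul V" "V \<subseteq> U"
    using locally_convex_spaceD(6)[OF lc U] by blast
  note sT = subspace_topspace
  define C where "C = {x \<in> topspace X. \<forall>c. norm c \<le> 1 \<longrightarrow> smul c x \<in> V}"
  have bal: "smul c x \<in> C" if "x \<in> C" "norm c \<le> 1" for c x
    using that subspace_scale[OF sT] by (auto simp: C_def norm_mult mult_le_one)
  have conv: "smul (of_real u) x + smul (of_real v) y \<in> C"
    if "x \<in> C" "y \<in> C" "u \<ge> 0" "v \<ge> 0" "u + v = 1" for x y u v
  proof -
    have "smul c (smul (of_real u) x + smul (of_real v) y) \<in> V" if "norm c \<le> 1" for c
    proof -
      have "smul (of_real u) (smul c x) + smul (of_real v) (smul c y) \<in> V"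
        using V(3) \<open>x \<in> C\<close> \<open>y \<in> C\<close> \<open>u \<ge> 0\<close> \<open>v \<ge> 0\<close> \<open>u + v = 1\<close> that
        unfolding convex_wrt_def C_def by blast
      then show ?thesis by (simp add: scale_right_distrib mult.commute)
    qed
    then show ?thesis
      using \<open>x \<in> C\<close> \<open>y \<in> C\<close> subspace_add[OF sT] subspace_scale[OF sT] by (auto simp: C_def)
  qed
  obtain N where N: "openin X N" "0 \<in> N" "N \<subseteq> C"
  proof -
    define Q where "Q = {z \<in> topspace (prod_topology euclidean X). (\<lambda>(c, x). smul c x) z \<in> V}"
    have "openin (prod_topology euclidean X) Q"
      unfolding Q_def
      by (rule openin_continuous_map_preimage[OF locally_convex_spaceD(5)[OF lc] V(1)])
    moreover have "(0, 0) \<in> Q" using V(2) subspace_0[OF sT] by (simp add: Q_def)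
    ultimately have "\<exists>A W. openin euclidean A \<and> openin X W \<and> 0 \<in> A \<and> 0 \<in> W \<and> A \<times> W \<subseteq> Q"
      by (rule openin_prod_topology_alt[THEN iffD1, rule_format])
    then obtain A W where AW0: "openin euclidean A"
        and AW: "openin X W" "0 \<in> A" "0 \<in> W" "A \<times> W \<subseteq> Q"
      by blast
    have "open A" using AW0 by simp
    obtain d where d0: "d > 0" "ball 0 d \<subseteq> A"
      using \<open>open A\<close> AW(2) by (rule openE)
    have d: "d > 0" "\<And>c. norm c < d \<Longrightarrow> c \<in> A"
      using d0 by auto
    \<comment> \<open>This is \<open>(d / 2) W\<close>. For \<open>norm c \<le> 1\<close> the scalar
      \<open>c * (d / 2)\<close> stays in the ball of radius \<open>d\<close>, so all multiples
      \<open>smul c x\<close> lie in \<open>V\<close>. The form \<open>x - 0\<close> matches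
      \<open>openin_smul_diff\<close>.\<close>
    let ?N = "{x \<in> topspace X. smul (of_real (2 / d)) (x - 0) \<in> W}"
    have "smul c x \<in> V" if "x \<in> ?N" "norm c \<le> 1" for c x
    proof -
      have n: "norm (c * of_real (d / 2)) < d"
        using that(2) d(1) mult_right_mono[of "norm c" 1 "d / 2"] by (simp add: norm_mult)
      then have "smul (c * of_real (d / 2)) (smul (of_real (2 / d)) x) \<in> V"
        using subsetD[OF AW(4), of "(c * of_real (d / 2), smul (of_real (2 / d)) x)"] d(2)[OF n] that(1)
        by (simp add: Q_def)
      moreover have "c * of_real (d / 2) * of_real (2 / d) = c"
        using d(1) by simp
      ultimately show ?thesis by (simp only: scale_scale)
    qed
    then show thesis
      using openin_smul_diff[OF AW(1) subspace_0[OF sT], of "of_real (2 / d)"] AW(3) subspace_0[OF sT]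
      by (intro that[of ?N]) (auto simp: C_def)
  qed
  \<comment> \<open>\<open>R x\<close> collects the factors \<open>r > 0\<close> with
    \<open>x \<in> r C\<close>; its infimum is the Minkowski functional of \<open>C\<close>.\<close>
  define R where "R x = {r. r > 0 \<and> smul (of_real (1 / r)) x \<in> C}" for x
  define q where "q x = Inf (R x)" for x
  have RC: "smul (of_real (1 / r)) x \<in> C" if "r \<in> R x" for r x
    using that unfolding R_def by blast
  have ne: "R x \<noteq> {}" if x: "x \<in> topspace X" for x
  proof -
    obtain d where d: "d > 0" "\<forall>c. norm c < d \<longrightarrow> smul c x \<in> N"
      using eventually_smul_mem[OF N(1,2) x] by blast
    then have "2 / d \<in> R x"
      using N(3) by (auto simp: R_def)
    then show ?thesis by blast
  qed
  have bdd: "bdd_below (R x)" for x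
    by (rule bdd_belowI[of _ 0]) (auto simp: R_def)
  \<comment> \<open>Since \<open>C\<close> is balanced, \<open>R x\<close> is closed upwards and
    hence contains everything above its infimum.\<close>
  have up: "s \<in> R x" if "r \<in> R x" "r \<le> s" for r s x
  proof -
    have rs: "r > 0" "s > 0" using that by (auto simp: R_def)
    have "smul (of_real (r / s)) (smul (of_real (1 / r)) x) \<in> C"
      using that rs by (intro bal[OF RC]) (auto simp: norm_divide)
    then have "smul (of_real (r / s * (1 / r))) x \<in> C" by (simp only: scale_scale of_real_mult)
    then show ?thesis using rs by (simp add: R_def)
  qed
  have q_le: "q x \<le> r" if "r \<in> R x" for r x
    unfolding q_def using cInf_lower[OF that bdd] .
  have q_ge: "b \<le> q x" if x: "x \<in> topspace X" and b: "\<And>r. r \<in> R x \<Longrightarrow> b \<le> r" for b x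
    unfolding q_def using ne[OF x] b by (rule cInf_greatest)
  have q_less: "s \<in> R x" if x: "x \<in> topspace X" and s: "q x < s" for s x
  proof -
    obtain r where "r \<in> R x" "r < s"
      using cInf_lessD[OF ne[OF x]] s unfolding q_def by blast
    then show ?thesis using up[of r x s] by simp
  qed
  have "seminorm_on smul (topspace X) q"
  proof (rule seminorm_onI[OF module_axioms sT])
    fix x y assume x: "x \<in> topspace X" and y: "y \<in> topspace X"
    have *: "r + s \<in> R (x + y)" if "r \<in> R x" "s \<in> R y" for r s
    proof -
      have rs: "r > 0" "s > 0" using that by (auto simp: R_def)
      \<comment> \<open>The weights \<open>r / (r + s)\<close> and \<open>s / (r + s)\<close> turn
        \<open>x / r\<close> and \<open>y / s\<close> into \<open>(x + y) / (r + s)\<close>, a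
        convex combination of points of \<open>C\<close>.\<close>
      have "smul (of_real (r / (r + s))) (smul (of_real (1 / r)) x)
          + smul (of_real (s / (r + s))) (smul (of_real (1 / s)) y) \<in> C"
        using rs by (intro conv[OF RC[OF that(1)] RC[OF that(2)]]) (auto simp flip: add_divide_distrib)
      then have "smul (of_real (r / (r + s) * (1 / r))) x
          + smul (of_real (s / (r + s) * (1 / s))) y \<in> C"
        by (simp only: scale_scale of_real_mult)
      then show ?thesis using rs by (simp add: R_def scale_right_distrib)
    qed
    have "q (x + y) - s \<le> q x" if "s \<in> R y" for s
      using q_le[OF *[OF _ that]] by (intro q_ge[OF x]) (simp add: algebra_simps)
    then have "q (x + y) - q x \<le> q y"
      by (intro q_ge[OF y]) (simp add: algebra_simps)
    then show "q (x + y) \<le> q x + q y" by simp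
  next
    fix c x assume x: "x \<in> topspace X" and c: "c \<noteq> (0::'k)"
    have "norm c * r \<in> R (smul c x)" if "r \<in> R x" for r
    proof -
      have r: "r > 0" using that by (auto simp: R_def)
      \<comment> \<open>The phase \<open>c / norm c\<close> has norm 1, so it preserves the balanced
        set \<open>C\<close>.\<close>
      have "smul (c / of_real (norm c)) (smul (of_real (1 / r)) x) \<in> C"
        using that c by (intro bal[OF RC]) (auto simp: norm_divide)
      then have "smul (of_real (1 / (norm c * r))) (smul c x) \<in> C" by (simp add: mult.commute)
      then show ?thesis using r c by (simp add: R_def)
    qed
    then have "q (smul c x) / norm c \<le> q x"
      using c by (intro q_ge[OF x]) (use q_le in \<open>fastforce simp: field_simps\<close>)
    then show "q (smul c x) \<le> norm c * q x" using c by (simp add: field_simps)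
  next
    have r: "r \<in> R 0" if "r > 0" for r
      using that N by (auto simp: R_def)
    have "q 0 \<ge> 0"
      by (intro q_ge[OF subspace_0[OF sT]]) (auto simp: R_def)
    moreover have "q 0 \<le> 0"
      by (rule field_le_epsilon) (use q_le[OF r] in auto)
    ultimately show "q 0 = 0" by simp
  qed
  moreover have "q x \<le> 1" if "x \<in> N" for x
    using that N(3) by (intro q_le) (auto simp: R_def)
  ultimately have "continuous_seminorm smul X q"
    by (rule continuous_seminormI[OF _ N(1,2)])
  moreover have "x \<in> U" if "x \<in> topspace X" "q x < 1" for x
  proof -
    have "x \<in> C" using q_less[OF that] by (simp add: R_def)
    then have "smul 1 x \<in> V" unfolding C_def by (auto simp del: scale_one)
    then show ?thesis using V(4) by auto
  qed
  ultimately show ?thesis by blast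
qed

text \<open>Take a continuous seminorm \<open>q\<close> on \<open>X\<close> dominating \<open>p\<close> on \<open>A\<close> with \<open>q \<ge> 1\<close> on \<open>x - A\<close>, and let
  \<open>P\<close> be the infimal convolution of \<open>p\<close> and \<open>q\<close>.\<close>

lemma seminorm_extension:
  assumes A: "subspace A" "closedin X A"
    and p: "continuous_seminorm smul (subtopology X A) p"
    and x: "x \<in> topspace X"
  shows "\<exists>P. continuous_seminorm smul X P \<and> (\<forall>y\<in>A. P y = p y) \<and> (x \<notin> A \<longrightarrow> 1 \<le> P x)"
proof -
  note sT = subspace_topspace
  have AX: "A \<subseteq> topspace X" using closedin_subset[OF A(2)] .
  have pA: "seminorm_on smul A p"
    using p AX by (simp add: continuous_seminorm_def Int_absorb1)
  note pD = seminorm_onD[OF module_axioms A(1) pA]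
  have "openin (subtopology X A) {y \<in> A. p y < 1}"
    using continuous_seminorm_less(1)[OF p, of 1] AX by (simp add: Int_absorb1)
  then obtain U1 where U1: "openin X U1" "{y \<in> A. p y < 1} = U1 \<inter> A"
    by (auto simp: openin_subtopology)
  \<comment> \<open>\<open>U2\<close> misses \<open>x - A\<close>, because
    \<open>x - (x - y) = y\<close>; hence a gauge whose open unit ball lies in \<open>U2\<close> is
    at least 1 on \<open>x - A\<close>. For \<open>x \<in> A\<close> the set \<open>U2\<close> would
    omit 0, so \<open>U\<close> then uses \<open>U1\<close> alone.\<close>
  define U2 where "U2 = {z \<in> topspace X. x - z \<in> topspace X - A}"
  have U2: "openin X U2"
    unfolding U2_def
    by (rule openin_continuous_map_preimage[of X X])
       (use x A(2) in \<open>auto intro!: continuous_map_diff\<close>)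
  define U where "U = (if x \<in> A then U1 else U1 \<inter> U2)"
  have oU: "openin X U" using U1(1) U2 by (auto simp: U_def)
  have UU1: "U \<subseteq> U1" by (simp add: U_def)
  have zU: "0 \<in> U"
  proof -
    have "0 \<in> {y \<in> A. p y < 1}" using pD(3) subspace_0[OF A(1)] by simp
    then have "0 \<in> U1" unfolding U1(2) by blast
    then show ?thesis using subspace_0[OF sT] x by (simp add: U_def U2_def)
  qed
  obtain q where q: "continuous_seminorm smul X q"
      and qU: "\<And>x. x \<in> topspace X \<Longrightarrow> q x < 1 \<Longrightarrow> x \<in> U"
    using gauge_exists[OF oU zU] by blast
  have qX: "seminorm_on smul (topspace X) q" using q by (simp add: continuous_seminorm_def)
  note qD = seminorm_onD[OF module_axioms sT qX]
  have pq: "p y \<le> q y" if y: "y \<in> A" for y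
  proof (rule ccontr)
    assume "\<not> p y \<le> q y"
    then obtain r where r: "q y < r" "r < p y" by (meson dense not_le)
    have yX: "y \<in> topspace X" using y AX by blast
    have r0: "r > 0" using r(1) qD(5)[OF yX] by simp
    \<comment> \<open>Scaling by a number \<open>r\<close> strictly between \<open>q y\<close> and
      \<open>p y\<close> gives a point of \<open>A\<close> in the unit ball of \<open>q\<close>,
      hence in \<open>U1\<close>, at which \<open>p\<close> exceeds 1.\<close>
    let ?z = "smul (of_real (1 / r)) y"
    have "q ?z < 1"
      using r r0 by (simp add: qD(2)[OF yX] norm_divide)
    then have "?z \<in> U1"
      using subsetD[OF UU1 qU[OF subspace_scale[OF sT yX]]] by blast
    then have "p ?z < 1"
      using U1(2) subspace_scale[OF A(1) y] by blast
    then show False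
      using r r0 by (simp add: pD(2)[OF y] norm_divide)
  qed
  define P where "P z = (INF y\<in>A. p y + q (z - y))" for z
  have ne: "A \<noteq> {}" using subspace_0[OF A(1)] by blast
  have P_le: "P z \<le> p y + q (z - y)" if z: "z \<in> topspace X" and y: "y \<in> A" for z y
    unfolding P_def
  proof (rule cINF_lower[OF bdd_belowI2[of _ 0] y])
    show "0 \<le> p y + q (z - y)" if "y \<in> A" for y
      using pD(5)[OF that] qD(5)[OF subspace_diff[OF sT z subsetD[OF AX that]]] by simp
  qed
  have P_ge: "b \<le> P z" if "\<And>y. y \<in> A \<Longrightarrow> b \<le> p y + q (z - y)" for b z
    unfolding P_def using ne that by (rule cINF_greatest)
  have P_eq: "P y = p y" if y: "y \<in> A" for y
  proof (rule antisym)
    show "P y \<le> p y" using P_le[of y y] y AX qD(3) by auto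
    show "p y \<le> P y"
    proof (rule P_ge)
      fix z assume z: "z \<in> A"
      have "p y \<le> p z + p (y - z)"
        using pD(1)[OF z subspace_diff[OF A(1) y z]] by simp
      then show "p y \<le> p z + q (y - z)"
        using pq[OF subspace_diff[OF A(1) y z]] by simp
    qed
  qed
  have "seminorm_on smul (topspace X) P"
  proof (rule seminorm_onI[OF module_axioms sT])
    fix u v assume u: "u \<in> topspace X" and v: "v \<in> topspace X"
    have *: "P (u + v) \<le> (p y + q (u - y)) + (p z + q (v - z))" if y: "y \<in> A" and z: "z \<in> A" for y z
    proof -
      have "P (u + v) \<le> p (y + z) + q (u + v - (y + z))"
        using subspace_add[OF sT u v] subspace_add[OF A(1) y z] by (rule P_le)
      moreover have "u + v - (y + z) = (u - y) + (v - z)" by simp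
      ultimately have "P (u + v) \<le> p (y + z) + q ((u - y) + (v - z))" by simp
      moreover have "p (y + z) \<le> p y + p z" using pD(1)[OF y z] .
      moreover have "q ((u - y) + (v - z)) \<le> q (u - y) + q (v - z)"
        using u v y z AX subspace_diff[OF sT] by (intro qD(1)) auto
      ultimately show ?thesis by linarith
    qed
    \<comment> \<open>The two infima are taken one after the other: over \<open>y\<close> with
      \<open>z\<close> fixed, then over \<open>z\<close>.\<close>
    have "P (u + v) - (p z + q (v - z)) \<le> P u" if "z \<in> A" for z
      using *[OF _ that] by (intro P_ge) (simp add: algebra_simps)
    then have "P (u + v) - P u \<le> P v"
      by (intro P_ge) (simp add: algebra_simps)
    then show "P (u + v) \<le> P u + P v" by simp
  next
    fix c u assume u: "u \<in> topspace X" and c: "c \<noteq> (0::'k)"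
    have "P (smul c u) / norm c \<le> P u"
    proof (rule P_ge)
      fix y assume y: "y \<in> A"
      then have "u - y \<in> topspace X" using u AX subspace_diff[OF sT] by blast
      then have "P (smul c u) \<le> norm c * (p y + q (u - y))"
        using P_le[OF subspace_scale[OF sT u] subspace_scale[OF A(1) y], of c c]
        by (simp add: pD(2)[OF y] qD(2) distrib_left flip: scale_right_diff_distrib)
      then show "P (smul c u) / norm c \<le> p y + q (u - y)" using c by (simp add: field_simps)
    qed
    then show "P (smul c u) \<le> norm c * P u" using c by (simp add: field_simps)
  next
    show "P 0 = 0" using P_eq[OF subspace_0[OF A(1)]] pD(3) by simp
  qed
  then have "continuous_seminorm smul X P"
  proof (rule continuous_seminormI)
    \<comment> \<open>The choice \<open>y = 0\<close> in the infimum gives \<open>P \<le> q\<close>,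
      so \<open>P\<close> is bounded by 1 on the unit ball of \<open>q\<close>.\<close>
    show "openin X {z \<in> topspace X. q z < 1}" using continuous_seminorm_less(1)[OF q] .
    show "0 \<in> {z \<in> topspace X. q z < 1}" using qD(3) subspace_0[OF sT] by simp
    show "P z \<le> 1" if "z \<in> {z \<in> topspace X. q z < 1}" for z
      using P_le[of z 0] that subspace_0[OF A(1)] pD(3) by simp
  qed
  moreover have "1 \<le> P x" if xA: "x \<notin> A"
  proof (rule P_ge)
    fix y assume y: "y \<in> A"
    then have xy: "x - y \<in> topspace X" using x AX subspace_diff[OF sT] by blast
    have "x - y \<notin> U2" using y by (simp add: U2_def)
    then have "1 \<le> q (x - y)" using qU[OF xy] xA by (force simp: U_def)
    then show "1 \<le> p y + q (x - y)" using pD(5)[OF y] by simp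
  qed
  ultimately show ?thesis using P_eq by blast
qed

lemma openin_seminorm_ball:
  assumes "continuous_seminorm smul X p" "x \<in> topspace X"
  shows "openin X {y \<in> topspace X. p (y - x) < r}"
proof -
  have "continuous_map X euclideanreal (p \<circ> (\<lambda>y. y - x))"
    using assms by (intro continuous_map_compose[of X X] continuous_map_diff)
      (auto simp: continuous_seminorm_def)
  from openin_continuous_map_preimage[OF this, of "{..<r}"] show ?thesis by simp
qed

text \<open>Metrizability gives a sequence in \<open>A\<close> tending to a given point of the
  closure. Its image filter is Cauchy, so it converges in \<open>A\<close>, and limits in
  \<open>X\<close> are unique.\<close>

lemma closedin_complete_subspace:
  assumes A: "subspace A" "A \<subseteq> topspace X"
    and met: "metrizable_space X" and comp: "tvs_complete (subtopology X A)"
  shows "closedin X A"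
proof -
  have "x \<in> A" if x: "x \<in> X closure_of A" for x
  proof -
    obtain M d where Md: "Metric_space M d" "X = Metric_space.mtopology M d"
      using met by (auto simp: metrizable_space_def)
    then obtain s where s: "range s \<subseteq> A" "limitin X s x sequentially"
      using x by (auto simp: Metric_space.closure_of_sequentially[OF Md(1)])
    have xX: "x \<in> topspace X" using limitin_topspace[OF s(2)] .
    have ev: "\<forall>\<^sub>F y in filtermap s sequentially. y \<in> B \<inter> A" if "openin X B" "x \<in> B" for B
    proof -
      have "\<forall>\<^sub>F k in sequentially. s k \<in> B" using s(2) that by (simp add: limitin_def)
      then show ?thesis using s(1) by (auto simp: eventually_filtermap elim!: eventually_mono)
    qed
    have "tvs_cauchy_filter (subtopology X A) (filtermap s sequentially)"
      unfolding tvs_cauchy_filter_def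
    proof (intro allI impI)
      fix W assume "openin (subtopology X A) W \<and> 0 \<in> W"
      then obtain U where U: "openin X U" "W = U \<inter> A" "0 \<in> U" by (auto simp: openin_subtopology)
      \<comment> \<open>Continuity of subtraction at \<open>(x, x)\<close> makes differences of late
        terms small.\<close>
      let ?Q = "{z \<in> topspace (prod_topology X X). fst z - snd z \<in> U}"
      have "openin (prod_topology X X) ?Q"
        by (rule openin_continuous_map_preimage[OF continuous_map_diff U(1)])
           (rule continuous_map_fst continuous_map_snd)+
      moreover have "(x, x) \<in> ?Q" using xX U(3) by simp
      ultimately have "\<exists>B C. openin X B \<and> openin X C \<and> x \<in> B \<and> x \<in> C \<and> B \<times> C \<subseteq> ?Q"
        by (rule openin_prod_topology_alt[THEN iffD1, rule_format])
      then obtain B C where BC: "openin X B" "openin X C" "x \<in> B" "x \<in> C" "B \<times> C \<subseteq> ?Q"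
        by blast
      have "y - z \<in> W" if "y \<in> B \<inter> A" "z \<in> C \<inter> A" for y z
        using subsetD[OF BC(5), of "(y, z)"] that subspace_diff[OF A(1)] U(2) by simp
      then show "\<forall>\<^sub>F (y, z) in filtermap s sequentially \<times>\<^sub>F filtermap s sequentially. y - z \<in> W"
        unfolding eventually_prod_filter
        by (intro exI[of _ "\<lambda>y. y \<in> B \<inter> A"] exI[of _ "\<lambda>y. y \<in> C \<inter> A"])
           (use ev[OF BC(1,3)] ev[OF BC(2,4)] in auto)
    qed
    moreover have "filtermap s sequentially \<le> principal (topspace (subtopology X A))"
      using s(1) A(2) by (auto simp: le_principal eventually_filtermap intro!: always_eventually)
    moreover have "filtermap s sequentially \<noteq> bot" by (simp add: filtermap_bot_iff)
    ultimately obtain l where "limitin (subtopology X A) (\<lambda>x. x) l (filtermap s sequentially)"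
      using comp unfolding tvs_complete_def by blast
    then have "l \<in> A" "limitin X s l sequentially"
      unfolding limitin_subtopology by (auto simp: limitin_def eventually_filtermap)
    moreover have "l = x"
      using \<open>limitin X s l sequentially\<close> s(2) metrizable_imp_Hausdorff_space[OF met]
      by (intro limitin_Hausdorff_unique[of X s l sequentially x]) auto
    ultimately show ?thesis by simp
  qed
  then have "X closure_of A \<subseteq> A" by (rule subsetI)
  then show ?thesis
    using A(2) closure_of_subset_eq[of A X] by simp
qed

end

section \<open>The locally convex topology of a single seminorm\<close>

text \<open>The topology generated by the balls of \<open>p\<close>, in general not Hausdorff. It
  serves as the test space to which the universal property of the limit is applied.\<close>

definition seminorm_topology :: "'a::ab_group_add set \<Rightarrow> ('a \<Rightarrow> real) \<Rightarrow> 'a topology" where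
  "seminorm_topology A p =
     topology (\<lambda>U. U \<subseteq> A \<and> (\<forall>x\<in>U. \<exists>e>0. \<forall>y\<in>A. p (y - x) < e \<longrightarrow> y \<in> U))"

lemma openin_seminorm_topology:
  "openin (seminorm_topology A p) U \<longleftrightarrow>
     U \<subseteq> A \<and> (\<forall>x\<in>U. \<exists>e>0. \<forall>y\<in>A. p (y - x) < e \<longrightarrow> y \<in> U)"
proof -
  let ?L = "\<lambda>U. U \<subseteq> A \<and> (\<forall>x\<in>U. \<exists>e>0. \<forall>y\<in>A. p (y - x) < e \<longrightarrow> y \<in> U)"
  have "?L (U \<inter> V)" if U: "?L U" and V: "?L V" for U V
  proof (intro conjI ballI)
    show "U \<inter> V \<subseteq> A" using U by blast
    fix x assume x: "x \<in> U \<inter> V"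
    obtain e where e: "e > 0" "\<forall>y\<in>A. p (y - x) < e \<longrightarrow> y \<in> U" using U x by blast
    obtain f where f: "f > 0" "\<forall>y\<in>A. p (y - x) < f \<longrightarrow> y \<in> V" using V x by blast
    show "\<exists>e>0. \<forall>y\<in>A. p (y - x) < e \<longrightarrow> y \<in> U \<inter> V"
      using e f by (intro exI[of _ "min e f"]) auto
  qed
  moreover have "?L (\<Union>K)" if K: "\<forall>U\<in>K. ?L U" for K
  proof (intro conjI ballI)
    show "\<Union>K \<subseteq> A" using K by blast
    fix x assume "x \<in> \<Union>K"
    then obtain U where U: "U \<in> K" "x \<in> U" by blast
    then obtain e where "e > 0" "\<forall>y\<in>A. p (y - x) < e \<longrightarrow> y \<in> U" using K by blast
    then show "\<exists>e>0. \<forall>y\<in>A. p (y - x) < e \<longrightarrow> y \<in> \<Union>K" using U(1) by blast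
  qed
  ultimately have "istopology ?L" unfolding istopology_def by blast
  then show ?thesis unfolding seminorm_topology_def by (simp add: topology_inverse')
qed

lemma topspace_seminorm_topology: "topspace (seminorm_topology A p) = A"
proof -
  have "openin (seminorm_topology A p) A"
    unfolding openin_seminorm_topology by (auto intro: exI[of _ 1])
  then have "A \<subseteq> topspace (seminorm_topology A p)" by (rule openin_subset)
  moreover have "topspace (seminorm_topology A p) \<subseteq> A"
    by (rule openin_seminorm_topology[THEN iffD1, OF openin_topspace, THEN conjunct1])
  ultimately show ?thesis by simp
qed

lemma openin_seminorm_topology_ball:
  assumes "module smul" "module.subspace smul A" "seminorm_on smul A p" "x \<in> A"
  shows "openin (seminorm_topology A p) {y \<in> A. p (y - x) < r}"
  unfolding openin_seminorm_topology
proof (intro conjI ballI)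
  interpret module smul by fact
  fix y assume y: "y \<in> {y \<in> A. p (y - x) < r}"
  have "p (z - x) < r" if z: "z \<in> A" "p (z - y) < r - p (y - x)" for z
  proof -
    have "p ((z - y) + (y - x)) \<le> p (z - y) + p (y - x)"
      using y z assms(4) subspace_diff[OF assms(2)] by (intro seminorm_onD(1)[OF assms(1-3)]) auto
    then show ?thesis using z(2) by simp
  qed
  then show "\<exists>e>0. \<forall>z\<in>A. p (z - y) < e \<longrightarrow> z \<in> {y \<in> A. p (y - x) < r}"
    using y by (intro exI[of _ "r - p (y - x)"]) auto
qed auto

lemma locally_convex_space_seminorm_topology:
  fixes smul :: "'k::real_normed_field \<Rightarrow> 'a::ab_group_add \<Rightarrow> 'a"
  assumes vs: "vector_space smul" and A: "module.subspace smul A" and p: "seminorm_on smul A p"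
  shows "locally_convex_space smul (seminorm_topology A p)"
proof -
  interpret vector_space smul by fact
  let ?F = "seminorm_topology A p"
  note pD = seminorm_onD[OF module_axioms A p]
  note ts = topspace_seminorm_topology[of A p]
  note ball = openin_seminorm_topology_ball[OF module_axioms A p]
  have add: "continuous_map (prod_topology ?F ?F) ?F (\<lambda>(x, y). x + y)"
    unfolding continuous_map_def
  proof (intro conjI allI impI)
    show "(\<lambda>(x, y). x + y) \<in> topspace (prod_topology ?F ?F) \<rightarrow> topspace ?F"
      using subspace_add[OF A] by (auto simp: ts)
    fix U assume U: "openin ?F U"
    show "openin (prod_topology ?F ?F) {z \<in> topspace (prod_topology ?F ?F). (\<lambda>(x, y). x + y) z \<in> U}"
      unfolding openin_prod_topology_alt
    proof (intro allI impI)
      fix x y assume "(x, y) \<in> {z \<in> topspace (prod_topology ?F ?F). (\<lambda>(x, y). x + y) z \<in> U}"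
      then have xy: "x \<in> A" "y \<in> A" "x + y \<in> U" by (auto simp: ts)
      obtain e where e: "e > 0" "\<And>z. z \<in> A \<Longrightarrow> p (z - (x + y)) < e \<Longrightarrow> z \<in> U"
        using U xy(3) unfolding openin_seminorm_topology by blast
      have "u + v \<in> U" if "u \<in> A" "p (u - x) < e / 2" "v \<in> A" "p (v - y) < e / 2" for u v
      proof (rule e(2))
        have "p ((u - x) + (v - y)) \<le> p (u - x) + p (v - y)"
          using xy that subspace_diff[OF A] by (intro pD(1)) auto
        moreover have "(u - x) + (v - y) = u + v - (x + y)" by simp
        ultimately show "p (u + v - (x + y)) < e" using that by simp
      qed (use that subspace_add[OF A] in blast)
      then show "\<exists>B C. openin ?F B \<and> openin ?F C \<and> x \<in> B \<and> y \<in> C \<and>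
          B \<times> C \<subseteq> {z \<in> topspace (prod_topology ?F ?F). (\<lambda>(x, y). x + y) z \<in> U}"
        using ball[OF xy(1), of "e / 2"] ball[OF xy(2), of "e / 2"] xy e(1) pD(3)
        by (intro exI[of _ "{u \<in> A. p (u - x) < e / 2}"] exI[of _ "{u \<in> A. p (u - y) < e / 2}"])
           (auto simp: ts)
    qed
  qed
  have scl: "continuous_map (prod_topology euclidean ?F) ?F (\<lambda>(c, x). smul c x)"
    unfolding continuous_map_def
  proof (intro conjI allI impI)
    show "(\<lambda>(c, x). smul c x) \<in> topspace (prod_topology euclidean ?F) \<rightarrow> topspace ?F"
      using subspace_scale[OF A] by (auto simp: ts)
    fix U assume U: "openin ?F U"
    show "openin (prod_topology euclidean ?F)
        {z \<in> topspace (prod_topology euclidean ?F). (\<lambda>(c, x). smul c x) z \<in> U}"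
      unfolding openin_prod_topology_alt
    proof (intro allI impI)
      fix c x
      assume "(c, x) \<in> {z \<in> topspace (prod_topology euclidean ?F). (\<lambda>(c, x). smul c x) z \<in> U}"
      then have cx: "x \<in> A" "smul c x \<in> U" by (auto simp: ts)
      obtain e where e: "e > 0" "\<And>z. z \<in> A \<Longrightarrow> p (z - smul c x) < e \<Longrightarrow> z \<in> U"
        using U cx(2) unfolding openin_seminorm_topology by blast
      \<comment> \<open>The radii come from
        \<open>smul b u - smul c x = smul b (u - x) + smul (b - c) x\<close>. The bound
        \<open>d \<le> 1\<close> gives \<open>norm b \<le> 1 + norm c\<close>, so that
        \<open>f\<close> keeps the first term below \<open>e / 2\<close>;
        \<open>d * p x < e / 2\<close> controls the second. Adding 1 to \<open>p x\<close> and to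
        \<open>norm c\<close> keeps the denominators positive.\<close>
      define d where "d = min 1 (e / (2 * (1 + p x)))"
      define f where "f = e / (2 * (1 + norm c))"
      have px: "p x \<ge> 0" using pD(5)[OF cx(1)] .
      have d: "d > 0" "d \<le> 1" "d * p x < e / 2"
      proof -
        show "d > 0" "d \<le> 1" using e(1) px by (auto simp: d_def)
        have "d * p x < d * (1 + p x)" using \<open>d > 0\<close> by simp
        also have "\<dots> \<le> e / (2 * (1 + p x)) * (1 + p x)"
          using px by (intro mult_right_mono) (auto simp: d_def)
        also have "\<dots> = e / 2"
        proof -
          have "e / (2 * k) * k = e / 2" if "k \<noteq> 0" for k using that by simp
          moreover have "1 + p x \<noteq> 0" using px by simp
          ultimately show ?thesis by blast
        qed
        finally show "d * p x < e / 2" .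
      qed
      have nc: "1 + norm c > 0" using norm_ge_zero[of c] by linarith
      have f: "f > 0" using e(1) nc by (simp add: f_def)
      have "smul b u \<in> U" if b: "dist b c < d" and u: "u \<in> A" "p (u - x) < f" for b u
      proof (rule e(2))
        have ux: "u - x \<in> A" using subspace_diff[OF A u(1) cx(1)] .
        have nb: "norm b \<le> 1 + norm c"
          using b d(2) norm_triangle_sub[of b c] by (simp add: dist_norm)
        have "p (smul b (u - x) + smul (b - c) x) \<le> p (smul b (u - x)) + p (smul (b - c) x)"
          using subspace_scale[OF A] ux cx(1) by (intro pD(1)) auto
        also have "\<dots> = norm b * p (u - x) + norm (b - c) * p x"
          by (simp add: pD(2)[OF ux] pD(2)[OF cx(1)])
        also have "\<dots> \<le> (1 + norm c) * p (u - x) + d * p x"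
          using nb b px pD(5)[OF ux] by (intro add_mono mult_right_mono) (auto simp: dist_norm)
        also have "\<dots> < (1 + norm c) * f + e / 2"
          using u(2) d(3) nc by (intro add_strict_mono mult_strict_left_mono)
        also have "\<dots> = e"
        proof -
          have "k * (e / (2 * k)) + e / 2 = e" if "k \<noteq> 0" for k using that by simp
          moreover have "1 + norm c \<noteq> 0" using nc by simp
          ultimately show ?thesis unfolding f_def by blast
        qed
        finally show "p (smul b u - smul c x) < e"
          by (simp add: scale_right_diff_distrib scale_left_diff_distrib)
      qed (use u subspace_scale[OF A] in blast)
      then show "\<exists>B C. openin euclidean B \<and> openin ?F C \<and> c \<in> B \<and> x \<in> C \<and>
          B \<times> C \<subseteq> {z \<in> topspace (prod_topology euclidean ?F). (\<lambda>(c, x). smul c x) z \<in> U}"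
        using ball[OF cx(1), of f] cx d(1) f pD(3)
        by (intro exI[of _ "ball c d"] exI[of _ "{u \<in> A. p (u - x) < f}"])
           (auto simp: ts dist_commute)
    qed
  qed
  have conv: "\<exists>V. openin ?F V \<and> 0 \<in> V \<and> convex_wrt smul V \<and> V \<subseteq> U" if U: "openin ?F U" "0 \<in> U" for U
  proof -
    obtain e where e: "e > 0" "\<And>z. z \<in> A \<Longrightarrow> p (z - 0) < e \<Longrightarrow> z \<in> U"
      using U unfolding openin_seminorm_topology by blast
    let ?V = "{y \<in> A. p (y - 0) < e}"
    have "convex_wrt smul ?V"
      unfolding convex_wrt_def
    proof (intro ballI allI impI)
      fix x y u v assume xy: "x \<in> ?V" "y \<in> ?V" and uv: "0 \<le> u" "0 \<le> v" "u + v = (1::real)"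
      let ?z = "smul (of_real u) x + smul (of_real v) y"
      have "p ?z \<le> p (smul (of_real u) x) + p (smul (of_real v) y)"
        using xy subspace_scale[OF A] by (intro pD(1)) auto
      also have "\<dots> = u * p x + v * p y" using xy uv by (simp add: pD(2))
      also have "\<dots> < e" using xy uv by (intro convex_bound_lt) auto
      finally show "?z \<in> ?V" using xy subspace_add[OF A] subspace_scale[OF A] by simp
    qed
    then show ?thesis
      using ball[OF subspace_0[OF A], of e] e subspace_0[OF A] pD(3) by (intro exI[of _ ?V]) auto
  qed
  show ?thesis
    unfolding locally_convex_space_def topological_vector_space_def
    using vs A add scl conv by (simp add: ts)
qed

section \<open>Strict sequences of Frechet spaces and their limit\<close>

locale strict_LF_sequence =
  fixes smul :: "'k::real_normed_field \<Rightarrow> 'a::ab_group_add \<Rightarrow> 'a"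
    and S :: "nat \<Rightarrow> 'a topology" and T :: "'a topology"
  assumes frechet: "Frechet_space smul (S n)"
    and inc: "topspace (S n) \<subseteq> topspace (S (Suc n))"
    and emb: "S n = subtopology (S (Suc n)) (topspace (S n))"
    and lim: "lc_direct_limit smul S T"
begin

lemma lc_S: "locally_convex_space smul (S n)"
  using frechet by (simp add: Frechet_space_def)

lemma tvs_S: "topological_vector_space smul (S n)"
  using lc_S by (simp add: locally_convex_space_def)

sublocale T: lc_space smul T
  using lim by unfold_locales (simp add: lc_direct_limit_def)

lemma lc_space_S: "lc_space smul (S n)"
  using lc_S by unfold_locales

lemmas subspace_S = locally_convex_spaceD(3)[OF lc_S]

lemma topspace_mono: "m \<le> n \<Longrightarrow> topspace (S m) \<subseteq> topspace (S n)"
  using lift_Suc_mono_le[of "\<lambda>n. topspace (S n)", OF inc] .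

lemma topspace_T: "topspace T = (\<Union>n. topspace (S n))"
  using lim tvs_S inc by (rule lc_direct_limit_topspace)

lemma S_eq_subtopology: "m \<le> n \<Longrightarrow> S m = subtopology (S n) (topspace (S m))"
proof (induction n rule: dec_induct)
  case (step n)
  have "S m = subtopology (subtopology (S (Suc n)) (topspace (S n))) (topspace (S m))"
    using step.IH emb[of n] by simp
  then show ?case
    using topspace_mono[OF step.hyps(1)] by (simp add: subtopology_subtopology Int_absorb1)
qed simp

lemma continuous_map_S_T: "continuous_map (S n) T (\<lambda>x. x)"
  using lim by (simp add: lc_direct_limit_def continuous_linear_map_def)

text \<open>By strictness the topology induced on the smaller step is \<open>S n\<close> itself,
  which is complete; complete subspaces of a metrizable space are closed.\<close>

lemma closedin_S_Suc: "closedin (S (Suc n)) (topspace (S n))"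
proof -
  interpret lc_space smul "S (Suc n)" by (rule lc_space_S)
  show ?thesis
    using frechet[of n] frechet[of "Suc n"] emb[of n] inc
    by (intro closedin_complete_subspace subspace_S) (simp_all add: Frechet_space_def)
qed

lemma exists_level:
  assumes "x \<in> topspace T" "x \<notin> topspace (S m)"
  shows "\<exists>n\<ge>m. x \<in> topspace (S (Suc n)) - topspace (S n)"
proof -
  define k where "k = (LEAST k. x \<in> topspace (S k))"
  have k: "x \<in> topspace (S k)" "\<And>j. j < k \<Longrightarrow> x \<notin> topspace (S j)"
  proof -
    obtain i where "x \<in> topspace (S i)" using assms(1) by (auto simp: topspace_T)
    then show "x \<in> topspace (S k)" unfolding k_def by (rule LeastI)
    show "x \<notin> topspace (S j)" if "j < k" for j using not_less_Least that unfolding k_def by blast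
  qed
  have "m < k" using assms(2) k(1) topspace_mono[of k m] by (meson not_le subsetD)
  \<comment> \<open>Since \<open>m < k\<close>, the index \<open>k - 1\<close> is a genuine
    predecessor and at least \<open>m\<close>; minimality of \<open>k\<close> keeps \<open>x\<close>
    out of that step.\<close>
  then show ?thesis using k by (intro exI[of _ "k - 1"]) auto
qed

text \<open>The topology of \<open>P\<close> alone is locally convex and coarser than each
  \<open>S n\<close> on its step, so the limit topology is finer than it. The unit ball of
  \<open>P\<close> is therefore open in \<open>T\<close>, which suffices for continuity.\<close>

lemma continuous_seminorm_T:
  assumes P: "\<And>n. continuous_seminorm smul (S n) P"
  shows "continuous_seminorm smul T P"
proof -
  have PS: "seminorm_on smul (topspace (S n)) P" for n
    using P by (simp add: continuous_seminorm_def)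
  have PT: "seminorm_on smul (topspace T) P"
    unfolding seminorm_on_def
  proof (intro conjI ballI allI)
    fix x y assume "x \<in> topspace T" "y \<in> topspace T"
    then obtain m n where "x \<in> topspace (S m)" "y \<in> topspace (S n)" by (auto simp: topspace_T)
    then have "x \<in> topspace (S (max m n))" "y \<in> topspace (S (max m n))"
      using topspace_mono[of m "max m n"] topspace_mono[of n "max m n"] by auto
    then show "P (x + y) \<le> P x + P y" using PS by (auto simp: seminorm_on_def)
  next
    fix c x assume "x \<in> topspace T"
    then show "P (smul c x) = norm c * P x" using PS by (auto simp: seminorm_on_def topspace_T)
  qed
  let ?F = "seminorm_topology (topspace T) P"
  have "continuous_map (S n) ?F (\<lambda>x. x)" for n
    unfolding continuous_map_def
  proof (intro conjI allI impI)
    show "(\<lambda>x. x) \<in> topspace (S n) \<rightarrow> topspace ?F"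
      by (auto simp: topspace_seminorm_topology topspace_T)
    fix U assume U: "openin ?F U"
    show "openin (S n) {x \<in> topspace (S n). x \<in> U}"
    proof (subst openin_subopen, safe)
      fix x assume x: "x \<in> topspace (S n)" "x \<in> U"
      obtain e where e: "e > 0" "\<And>y. y \<in> topspace T \<Longrightarrow> P (y - x) < e \<Longrightarrow> y \<in> U"
        using U x(2) unfolding openin_seminorm_topology by blast
      have "openin (S n) {y \<in> topspace (S n). P (y - x) < e}"
        using lc_space.openin_seminorm_ball[OF lc_space_S P x(1)] .
      then show "\<exists>N. openin (S n) N \<and> x \<in> N \<and> N \<subseteq> {x \<in> topspace (S n). x \<in> U}"
        using e x(1) seminorm_onD(3)[OF T.module_axioms T.subspace_topspace PT]
        by (intro exI[of _ "{y \<in> topspace (S n). P (y - x) < e}"]) (auto simp: topspace_T)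
    qed
  qed
  then have "continuous_map T ?F (\<lambda>x. x)"
    by (intro lc_direct_limit_finest[OF lim tvs_S inc]
        locally_convex_space_seminorm_topology[OF T.vector_space_axioms T.subspace_topspace PT]
        topspace_seminorm_topology)
  from openin_continuous_map_preimage[OF this
      openin_seminorm_topology_ball[OF T.module_axioms T.subspace_topspace PT
        T.subspace_0[OF T.subspace_topspace], of 1]]
  have "openin T {y \<in> topspace T. P y < 1}" by simp
  then show ?thesis
    using seminorm_onD(3)[OF T.module_axioms T.subspace_topspace PT] T.subspace_0[OF T.subspace_topspace]
    by (intro T.continuous_seminormI[OF PT, of "{y \<in> topspace T. P y < 1}"]) auto
qed

text \<open>The zero seminorm on step \<open>m\<close> is extended one step at a time by
  \<open>seminorm_extension\<close>, which leaves room for one lower bound per step. A constant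
  \<open>t\<close> separates a point from a step; a varying \<open>t\<close> controls a whole
  sequence.\<close>

lemma exists_seminorm:
  "\<exists>P. continuous_seminorm smul T P \<and> (\<forall>x\<in>topspace (S m). P x = 0) \<and>
     (\<forall>n\<ge>m. t n \<in> topspace (S (Suc n)) - topspace (S n) \<longrightarrow> 1 \<le> P (t n))"
proof -
  \<comment> \<open>Dependent choice: \<open>Q\<close> is the requirement on the seminorm of stage
    \<open>n\<close>, and \<open>R\<close> says that the next one extends it and is large at
    \<open>t n\<close>.\<close>
  define Q where "Q n p \<longleftrightarrow> continuous_seminorm smul (S n) p \<and>
    (n \<le> m \<longrightarrow> (\<forall>x\<in>topspace (S n). p x = 0))" for n and p :: "'a \<Rightarrow> real"
  define R where "R n p p' \<longleftrightarrow> (\<forall>x\<in>topspace (S n). p' x = p x) \<and>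
    (m \<le> n \<longrightarrow> t n \<in> topspace (S (Suc n)) - topspace (S n) \<longrightarrow> 1 \<le> p' (t n))"
    for n and p p' :: "'a \<Rightarrow> real"
  have "\<exists>p. \<forall>n. Q n (p n) \<and> R n (p n) (p (Suc n))"
  proof (rule dependent_nat_choice)
    show "\<exists>p. Q 0 p"
      by (rule exI[of _ "\<lambda>_. 0"]) (simp add: Q_def continuous_seminorm_zero)
  next
    fix p n assume p: "Q n p"
    show "\<exists>p'. Q (Suc n) p' \<and> R n p p'"
    proof (cases "n < m")
      case True
      then show ?thesis
        using p by (intro exI[of _ "\<lambda>_. 0"]) (simp add: Q_def R_def continuous_seminorm_zero)
    next
      case False
      \<comment> \<open>The extension lemma needs a point of the carrier. The default 0 is taken
        only when \<open>t n\<close> lies outside step \<open>n + 1\<close>, and there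
        \<open>R\<close> demands no lower bound.\<close>
      define x where "x = (if t n \<in> topspace (S (Suc n)) then t n else 0)"
      interpret lc_space smul "S (Suc n)" by (rule lc_space_S)
      have "x \<in> topspace (S (Suc n))" using T.subspace_0[OF subspace_S] by (simp add: x_def)
      then obtain P where "continuous_seminorm smul (S (Suc n)) P"
          "\<forall>y\<in>topspace (S n). P y = p y" "x \<notin> topspace (S n) \<longrightarrow> 1 \<le> P x"
        using seminorm_extension[OF subspace_S closedin_S_Suc, of p x] p emb[of n]
        by (auto simp: Q_def)
      then show ?thesis using False by (intro exI[of _ P]) (auto simp: Q_def R_def x_def)
    qed
  qed
  then obtain p where p: "\<And>n. Q n (p n)" "\<And>n. R n (p n) (p (Suc n))" by blast
  have ple: "p n x = p k x" if "k \<le> n" "x \<in> topspace (S k)" for k n x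
    using that
  proof (induction n rule: dec_induct)
    case (step n)
    then show ?case using p(2)[of n] topspace_mono[OF step.hyps(1)] by (auto simp: R_def)
  qed simp
  \<comment> \<open>Gluing: the stages agree on common steps, so any index whose step contains
    \<open>x\<close> gives the same value.\<close>
  define P where "P x = p (LEAST n. x \<in> topspace (S n)) x" for x
  have P: "P x = p n x" if "x \<in> topspace (S n)" for n x
    unfolding P_def using ple[of "LEAST n. x \<in> topspace (S n)" n x] that
    by (metis (no_types, lifting) LeastI Least_le)
  have "continuous_seminorm smul (S n) P" for n
  proof -
    have "continuous_map (S n) euclideanreal P"
      by (rule continuous_map_eq[of _ _ "p n"])
         (use p(1)[of n] P in \<open>auto simp: Q_def continuous_seminorm_def\<close>)
    moreover have "seminorm_on smul (topspace (S n)) P"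
      using p(1)[of n] P[of _ n] T.subspace_add[OF subspace_S] T.subspace_scale[OF subspace_S]
      by (simp add: Q_def continuous_seminorm_def seminorm_on_def)
    ultimately show ?thesis by (simp add: continuous_seminorm_def)
  qed
  then have "continuous_seminorm smul T P" by (rule continuous_seminorm_T)
  moreover have "P x = 0" if "x \<in> topspace (S m)" for x
    using P[OF that] p(1)[of m] that by (simp add: Q_def)
  moreover have "1 \<le> P (t n)" if "m \<le> n" "t n \<in> topspace (S (Suc n)) - topspace (S n)" for n
    using P[of "t n" "Suc n"] p(2)[of n] that by (simp add: R_def)
  ultimately show ?thesis by blast
qed

text \<open>A point outside step \<open>n\<close> first appears just after some step
  \<open>j \<ge> n\<close>. A continuous seminorm that vanishes on step \<open>j\<close> but not at
  the point is positive on a neighbourhood of it that avoids step \<open>n\<close>.\<close>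

lemma closedin_T: "closedin T (topspace (S n))"
proof -
  have "openin T (topspace T - topspace (S n))"
  proof (subst openin_subopen, safe)
    fix x assume x: "x \<in> topspace T" "x \<notin> topspace (S n)"
    obtain j where j: "j \<ge> n" "x \<in> topspace (S (Suc j)) - topspace (S j)"
      using exists_level[OF x] by blast
    obtain P where P: "continuous_seminorm smul T P" "\<forall>y\<in>topspace (S j). P y = 0" "1 \<le> P x"
      using exists_seminorm[of j "\<lambda>_. x"] j(2) by blast
    have "y \<notin> topspace (S n)" if "0 < P y" for y
      using that P(2) topspace_mono[OF j(1)] by force
    then show "\<exists>N. openin T N \<and> x \<in> N \<and> N \<subseteq> topspace T - topspace (S n)"
      using continuous_seminorm_less(2)[OF P(1), of 0] x(1) P(3)
      by (intro exI[of _ "{y \<in> topspace T. 0 < P y}"]) auto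
  qed
  then show ?thesis by (auto simp: closedin_def topspace_T)
qed

lemma continuous_seminorm_tendsto_0:
  assumes "continuous_seminorm smul T P" "limitin T s 0 sequentially" "r > 0"
  shows "\<forall>\<^sub>F k in sequentially. P (s k) < r"
proof -
  have "P 0 = 0"
    using assms(1) seminorm_onD(3)[OF T.module_axioms T.subspace_topspace]
    by (simp add: continuous_seminorm_def)
  then have "0 \<in> {y \<in> topspace T. P y < r}"
    using T.subspace_0[OF T.subspace_topspace] assms(3) by simp
  then have "\<forall>\<^sub>F k in sequentially. s k \<in> {y \<in> topspace T. P y < r}"
    using assms(2) continuous_seminorm_less(1)[OF assms(1)] unfolding limitin_def by blast
  then show ?thesis by (rule eventually_mono) simp
qed

text \<open>Otherwise terms occur in gaps between steps arbitrarily far out. A continuous seminorm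
  that is at least 1 at one term of each such gap contradicts convergence to 0.\<close>

lemma null_sequence_in_step:
  assumes s: "range s \<subseteq> topspace T" "limitin T s 0 sequentially"
  shows "\<exists>m. range s \<subseteq> topspace (S m)"
proof (rule ccontr)
  assume "\<not> ?thesis"
  then have out: "\<exists>k. s k \<notin> topspace (S m)" for m by blast
  \<comment> \<open>One term of the sequence is chosen in each gap that contains any; in the other
    gaps the value is arbitrary and never consulted.\<close>
  define t where "t n = (SOME y. y \<in> range s \<inter> (topspace (S (Suc n)) - topspace (S n)))" for n
  obtain P where P: "continuous_seminorm smul T P"
      "\<And>n. t n \<in> topspace (S (Suc n)) - topspace (S n) \<Longrightarrow> 1 \<le> P (t n)"
    using exists_seminorm[of 0 t] by auto
  obtain K where K: "\<And>k. k \<ge> K \<Longrightarrow> P (s k) < 1"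
    using continuous_seminorm_tendsto_0[OF P(1) s(2), of 1] by (auto simp: eventually_sequentially)
  \<comment> \<open>The finitely many terms before \<open>K\<close> lie in a common step.\<close>
  have "\<exists>m. \<forall>k<K. s k \<in> topspace (S m)"
  proof (induction K)
    case (Suc K)
    then obtain m where m: "\<forall>k<K. s k \<in> topspace (S m)" by blast
    obtain n where n: "s K \<in> topspace (S n)" using s(1) by (force simp: topspace_T)
    have "\<forall>k<Suc K. s k \<in> topspace (S (max m n))"
      using m n topspace_mono[of m "max m n"] topspace_mono[of n "max m n"]
      by (auto simp: less_Suc_eq)
    then show ?case by blast
  qed simp
  then obtain m where m: "\<forall>k<K. s k \<in> topspace (S m)" by blast
  obtain k where k: "s k \<notin> topspace (S m)" using out by blast
  obtain j where j: "j \<ge> m" "s k \<in> topspace (S (Suc j)) - topspace (S j)"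
    using exists_level[OF _ k] s(1) by blast
  \<comment> \<open>The term chosen in this gap may differ from \<open>s k\<close>. It too lies
    outside step \<open>m\<close>, so its index is at least \<open>K\<close>, where \<open>P\<close>
    is below 1.\<close>
  have "t j \<in> range s \<inter> (topspace (S (Suc j)) - topspace (S j))"
    unfolding t_def by (rule someI[of _ "s k"]) (use j(2) in blast)
  then obtain i where i: "t j = s i" and tj: "t j \<in> topspace (S (Suc j)) - topspace (S j)" by blast
  have "i \<ge> K" using m i tj topspace_mono[OF j(1)] by (metis DiffD2 not_le subsetD)
  then show False using K[of i] P(2)[OF tj] i by simp
qed

lemma kappa_Frechet_Urysohn_imp_stationary:
  assumes "kappa_Frechet_Urysohn T"
  shows "\<exists>n. topspace (S n) = topspace T"
proof (rule ccontr)
  assume "\<not> ?thesis"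
  then have "topspace T - topspace (S n) \<noteq> {}" for n
    using topspace_T by auto
  then have proper: "\<exists>z. z \<in> topspace T \<and> z \<notin> topspace (S n)" for n by blast
  note sT = T.subspace_topspace
  obtain a where a: "a \<in> topspace T" "a \<notin> topspace (S 0)" using proper by blast
  obtain j where j: "a \<in> topspace (S (Suc j)) - topspace (S j)"
    using exists_level[OF a] by blast
  \<comment> \<open>The constant sequence \<open>a\<close> yields a non-zero continuous
    seminorm.\<close>
  obtain P where P: "continuous_seminorm smul T P" "1 \<le> P a"
    using exists_seminorm[of j "\<lambda>_. a"] j by blast
  define W where "W n = {y \<in> topspace T. 1 / real (Suc n) < P y}" for n
  have W: "openin T (W n)" for n
    unfolding W_def by (rule continuous_seminorm_less(2)[OF P(1)])
  define U where "U = (\<Union>n. W n - topspace (S n))"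
  have "openin T U"
    unfolding U_def using W closedin_T by (intro openin_Union) (auto intro: openin_diff)
  moreover have "0 \<in> T closure_of U"
    unfolding in_closure_of
  proof (intro conjI allI impI)
    show "0 \<in> topspace T" using T.subspace_0[OF sT] .
    fix N assume N: "0 \<in> N \<and> openin T N"
    obtain d where d: "d > 0" "\<forall>c. norm c < d \<longrightarrow> smul c a \<in> N"
      using T.eventually_smul_mem[of N a] N a(1) by blast
    \<comment> \<open>A small multiple of \<open>a\<close> lies in \<open>N\<close> and still has
      \<open>P b > 0\<close>, hence belongs to some \<open>W n\<close>. If it happens to lie in step
      \<open>n\<close>, it is moved off that step below.\<close>
    define b where "b = smul (of_real (d / 2)) a"
    have b: "b \<in> N" "b \<in> topspace T" "P b > 0"
    proof -
      show "b \<in> N" using d by (simp add: b_def norm_divide del: of_real_divide)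
      show "b \<in> topspace T" using T.subspace_scale[OF sT a(1)] by (simp add: b_def)
      have "P b = d / 2 * P a"
        using P(1) a(1) d(1) by (simp add: continuous_seminorm_def seminorm_on_def b_def norm_divide)
      moreover have "d / 2 * P a > 0" using d(1) P(2) by (intro mult_pos_pos) auto
      ultimately show "P b > 0" by simp
    qed
    obtain n where n: "1 / real (Suc n) < P b"
      using reals_Archimedean[OF b(3)] by (auto simp: inverse_eq_divide)
    have "\<exists>y. y \<in> N \<inter> W n \<and> y \<notin> topspace (S n)"
    proof (cases "b \<in> topspace (S n)")
      case False
      then show ?thesis using b n by (auto simp: W_def)
    next
      case True
      obtain z where z: "z \<in> topspace T" "z \<notin> topspace (S n)" using proper by blast
      let ?M = "{w \<in> topspace T. b + w \<in> N \<inter> W n}"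
      have "openin T ?M"
        by (rule openin_continuous_map_preimage[of T T])
           (use b(2) N W in \<open>auto intro!: T.continuous_map_add\<close>)
      moreover have "0 \<in> ?M" using T.subspace_0[OF sT] b n by (simp add: W_def)
      ultimately obtain e where e: "e > 0" "\<forall>c. norm c < e \<longrightarrow> smul c z \<in> ?M"
        using T.eventually_smul_mem[OF _ _ z(1)] by blast
      \<comment> \<open>The perturbation \<open>smul c z\<close> is small enough to stay in
        \<open>N \<inter> W n\<close>. As \<open>c \<noteq> 0\<close>, the point \<open>z\<close>
        outside step \<open>n\<close> could be recovered from \<open>b + smul c z\<close>, so the
        sum is outside as well.\<close>
      define c where "c = (of_real (e / 2) :: 'k)"
      have c: "c \<noteq> 0" "norm c < e" using e(1) by (simp_all add: c_def norm_divide)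
      have "b + smul c z \<notin> topspace (S n)"
      proof
        assume "b + smul c z \<in> topspace (S n)"
        then have "smul (inverse c) (b + smul c z - b) \<in> topspace (S n)"
          using True T.subspace_diff[OF subspace_S] T.subspace_scale[OF subspace_S] by blast
        then show False using z(2) c(1) by simp
      qed
      then show ?thesis using e(2) c(2) by blast
    qed
    then show "\<exists>y. y \<in> U \<and> y \<in> N" unfolding U_def by blast
  qed
  ultimately obtain s where s: "range s \<subseteq> U" "limitin T s 0 sequentially"
    using assms unfolding kappa_Frechet_Urysohn_def by blast
  have "range s \<subseteq> topspace T" using s(1) by (auto simp: U_def W_def)
  then obtain m where m: "range s \<subseteq> topspace (S m)" using null_sequence_in_step s(2) by blast
  \<comment> \<open>A term from \<open>W n\<close> outside step \<open>n\<close> but inside step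
    \<open>m\<close> forces \<open>n \<le> m\<close>, so the threshold of \<open>W n\<close> is at
    least that of \<open>W m\<close>.\<close>
  have large: "1 / real (Suc m) < P (s k)" for k
  proof -
    obtain n where n: "s k \<in> W n" "s k \<notin> topspace (S n)" using s(1) by (auto simp: U_def)
    have "n \<le> m" using n(2) m topspace_mono[of m n] by (meson nat_le_linear rangeI subsetD)
    then have "1 / real (Suc m) \<le> 1 / real (Suc n)" by (simp add: frac_le)
    then show ?thesis using n(1) by (simp add: W_def)
  qed
  have "\<forall>\<^sub>F k in sequentially. P (s k) < 1 / real (Suc m)"
    using continuous_seminorm_tendsto_0[OF P(1) s(2)] by simp
  then obtain k where "P (s k) < 1 / real (Suc m)"
    by (auto simp: eventually_sequentially)
  then show False using large[of k] by simp
qed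

text \<open>All steps include continuously into \<open>S n\<close>, so the limit topology is finer
  than \<open>S n\<close>; continuity of the inclusion of \<open>S n\<close> into \<open>T\<close>
  gives the converse.\<close>

lemma stationary_imp_eq:
  assumes n: "topspace (S n) = topspace T"
  shows "T = S n"
proof -
  have "continuous_map (S k) (S n) (\<lambda>x. x)" for k
  proof (cases "k \<le> n")
    case True
    have "continuous_map (subtopology (S n) (topspace (S k))) (S n) (\<lambda>x. x)"
      by (intro continuous_map_from_subtopology) simp
    then show ?thesis by (simp only: S_eq_subtopology[OF True, symmetric])
  next
    case False
    \<comment> \<open>A later step is squeezed between step \<open>n\<close> and the whole space,
      and strictness then makes the two topologies equal.\<close>
    then have eq: "topspace (S k) = topspace (S n)"
      using n topspace_mono[of n k] by (auto simp: topspace_T)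
    have "S n = subtopology (S k) (topspace (S k))"
      unfolding eq by (rule S_eq_subtopology) (use False in simp)
    then have "S n = S k" by (simp only: subtopology_topspace)
    then show ?thesis by simp
  qed
  then have T_S: "continuous_map T (S n) (\<lambda>x. x)"
    by (intro lc_direct_limit_finest[OF lim tvs_S inc lc_S n])
  have "openin X U" if "continuous_map X Y (\<lambda>x. x)" "topspace X = topspace Y" "openin Y U"
    for X Y :: "'a topology" and U
  proof -
    have "{x \<in> topspace X. x \<in> U} = U" using openin_subset[OF that(3)] that(2) by auto
    then show ?thesis using openin_continuous_map_preimage[OF that(1,3)] by simp
  qed
  from this[OF T_S n[symmetric]] this[OF continuous_map_S_T n] show ?thesis
    unfolding topology_eq by blast
qed

end

section \<open>The equivalence\<close>

lemma metrizable_imp_kappa_Frechet_Urysohn: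
  assumes "metrizable_space T"
  shows "kappa_Frechet_Urysohn T"
proof -
  obtain M d where Md: "Metric_space M d" "T = Metric_space.mtopology M d"
    using assms by (auto simp: metrizable_space_def)
  show ?thesis
    unfolding kappa_Frechet_Urysohn_def Md(2)
    by (auto simp: Metric_space.closure_of_sequentially[OF Md(1)])
qed

text \<open>Stated over an arbitrary real normed field, so that the real and the complex case are
  both instances.\<close>

lemma strict_LF_kappa_Frechet_Urysohn_iff:
  fixes smul :: "'k::real_normed_field \<Rightarrow> 'a::ab_group_add \<Rightarrow> 'a"
  assumes "strict_LF_space smul T"
  shows "kappa_Frechet_Urysohn T \<longleftrightarrow> Frechet_space smul T"
proof
  obtain S where "strict_LF_sequence smul S T"
    using assms unfolding strict_LF_space_def strict_LF_sequence_def by blast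
  then interpret strict_LF_sequence smul S T .
  assume "kappa_Frechet_Urysohn T"
  then obtain n where "topspace (S n) = topspace T"
    using kappa_Frechet_Urysohn_imp_stationary by blast
  then have "T = S n" by (rule stationary_imp_eq)
  then show "Frechet_space smul T" using frechet[of n] by simp
next
  assume "Frechet_space smul T"
  then show "kappa_Frechet_Urysohn T"
    by (simp add: Frechet_space_def metrizable_imp_kappa_Frechet_Urysohn)
qed

theorem corollary2p7:
  fixes smulR :: "real \<Rightarrow> 'a::ab_group_add \<Rightarrow> 'a" and E :: "'a topology"
    and smulC :: "complex \<Rightarrow> 'b::ab_group_add \<Rightarrow> 'b" and E' :: "'b topology"
  shows "(strict_LF_space smulR E \<longrightarrow> (kappa_Frechet_Urysohn E \<longleftrightarrow> Frechet_space smulR E)) \<and>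
         (strict_LF_space smulC E' \<longrightarrow> (kappa_Frechet_Urysohn E' \<longleftrightarrow> Frechet_space smulC E'))"
  by (simp add: strict_LF_kappa_Frechet_Urysohn_iff)

end
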